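(* Let $\tilde N=(\tilde V,\tilde E,\mathrm{wt})$ be a cylindrical network with shift vector $\tilde g$ and projection $N$, and let $\tilde u,\tilde v\in\tilde V$ be any two vertices. For $\ell\ge 0$ put $\tilde v_\ell=\tilde v+\ell\tilde g$ and define $f:\mathbb N\to K$ by $f(\ell)=\tilde N(\tilde u,\tilde v_\ell)$. Then $f$ satisfies a linear recurrence with characteristic polynomial $Q_N(t)$ (i.e. the recurrence holds for all but finitely many $\ell$).
   Context: Let $K$ be a field of characteristic zero. Fix reals $A<B$, the strip $\mathcal S=\{(x,y)\in\mathbb R^2: A\le y\le B\}$ and a vector $\tilde g=(m,0)$ with $m>0$. A cylindrical network is a triple $\tilde N=(\tilde V,\tilde E,\mathrm{wt})$ such that: (1) $\tilde V$ is a discrete subset of $\mathcal S$ with $\tilde V+\tilde g=\tilde V$; (2) $\tilde E\subset\tilde V\times\tilde V$ is a set of ordered pairs (directed edges) such that $(\tilde u,\tilde v)\in\tilde E$ implies $(\tilde u+\tilde g,\tilde v+\tilde g)\in\tilde E$; (3) $\mathrm{wt}:\tilde E\to K$ satisfies $\mathrm{wt}(\tilde e+\tilde g)=\mathrm{wt}(\tilde e)$; (4) every vertex has finitely many incoming and finitely many outgoing edges; (5) if for some $\ell\in\mathbb Z$ there is a directed path in $\tilde N$ from $\tilde v$ to $\tilde v+\ell\tilde g$, then $\ell>0$ (so $\tilde N$ is acyclic). The projection $N$ is the finite weighted directed graph with vertex set $V=\tilde V/\mathbb Z\tilde g$, edge set $E=\tilde E/\mathbb Z\tilde g$ (the class of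 $(\tilde u,\tilde v)$ is an edge from the class of $\tilde u$ to the class of $\tilde v$), with inherited weights. A simple cycle $C$ of $N$ is a directed cycle visiting each vertex at most once; $\mathrm{wt}(C)$ is the product of its edge weights, and its winding number $\mathrm{wind}(C)$ is the integer $\ell$ such that any lift of $C$ to a path in $\tilde N$ goes from some $\tilde w$ to $\tilde w+\ell\tilde g$ (so $\mathrm{wind}(C)\ge1$). An $r$-cycle $\mathbf C$ is a collection of $r$ pairwise vertex-disjoint simple cycles $C_1,\dots,C_r$ of $N$ (each collection counted once); $\mathrm{wt}(\mathbf C)=\prod_i\mathrm{wt}(C_i)$, $\mathrm{wind}(\mathbf C)=\sum_i\mathrm{wind}(C_i)$; $\mathcal C^r(N)$ is the set of $r$-cycles ($\mathcal C^0(N)$ consists of the empty collection, with weight $1$ and winding number $0$). Let $d$ be the maximal winding number of an $r$-cycle over all $r\ge0$, and $Q_N(t)=\sum_{r\ge 0}(-1)^{d-r}\sum_{\mathbf C\in\mathcal C^r(N)}t^{d-\mathrm{wind}(\mathbf C)}\mathrm{wt}(\mathbf C)\in K[t]$, a monic polynomial of degree $d$. For $\tilde u,\tilde v\in\tilde V$, $\tilde N(\tilde u,\tilde v)$ is the (finite) sum over all directed paths from $\tilde u$ to $\tilde v$ in $\tilde N$ of the product of the weights of their edges (the trivial path, if $\tilde u=\tilde v$, has weight $1$). A sequence $f:\mathbb N\to K$ satisfies a linear recurrence with characteristic polynomial $Q(t)=t^D-\alpha_1t^{D-1}+\dots+(-1)^D\alpha_D\in K[t]$ if $f(n+D)-\alpha_1f(n+D-1)+\dots+(-1)^D\alpha_Df(n)=0$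 for all but finitely many $n\in\mathbb N$.
   Formalization: As displayed, Q_N(t) has leading coefficient (-1)^d, so it is not monic for odd d (one loop of winding 1 and weight w gives -t+w); the characteristic polynomial is therefore allowed leading coefficient 1 or -1, which leaves the recurrence itself unchanged. *)

theory Defs
  imports
    "HOL-Analysis.Analysis"
    "HOL-Computational_Algebra.Polynomial"
    "Graph_Theory.Arc_Walk"
begin

type_synonym point = "real \<times> real"

definition strip :: "real \<Rightarrow> real \<Rightarrow> point set" where
  "strip A B = {(x, y). A \<le> y \<and> y \<le> B}"

text \<open>
  \<open>X // translates g X\<close> is the quotient of \<open>X\<close> by \<open>\<int> g\<close>.  It is used for vertices with the
  vector \<open>g\<close> and for edges (pairs of points) with the vector \<open>(g, g)\<close>.
\<close>

definition translates :: "'a::real_vector \<Rightarrow> 'a set \<Rightarrow> ('a \<times> 'a) set" where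
  "translates g X = {(x, y). x \<in> X \<and> y \<in> X \<and> (\<exists>k::int. y = x + of_int k *\<^sub>R g)}"

definition cover_graph :: "point set \<Rightarrow> (point \<times> point) set \<Rightarrow> (point, point \<times> point) pre_digraph"
  where "cover_graph V E = \<lparr>verts = V, arcs = E, tail = fst, head = snd\<rparr>"

text \<open>
  The relational image in \<open>tail\<close> and \<open>head\<close> yields the full vertex class of the tails (heads) of
  the representatives of an edge class.  Distinct edge classes may have the same ends, so the
  projection is a multigraph, possibly with loops.
\<close>

definition projection ::
  "point \<Rightarrow> point set \<Rightarrow> (point \<times> point) set \<Rightarrow> (point set, (point \<times> point) set) pre_digraph" where
  "projection g V E =
    \<lparr>verts = V // translates g V, arcs = E // translates (g, g) E,
     tail = (\<lambda>c. translates g V `` (fst ` c)), head = (\<lambda>c. translates g V `` (snd ` c))\<rparr>"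

definition edge_class :: "point \<Rightarrow> (point \<times> point) set \<Rightarrow> point \<times> point \<Rightarrow> (point \<times> point) set" where
  "edge_class g E e = translates (g, g) E `` {e}"

text \<open>
  The library's \<open>discrete\<close> only says that the points of \<open>V\<close> are isolated, and
  \<open>shift_edges\<close> is one implication, so finiteness of the projection is listed explicitly; it is
  automatic if \<open>V\<close> has no limit point in the strip and \<open>E\<close> is also closed under translation
  by \<open>-g\<close> (see \<open>fin_digraph_projection\<close> below).  In \<open>acyclic\<close> the trivial path is excluded:
  it leads from \<open>v\<close> to \<open>v + 0 g\<close>.  Only the values of \<open>wt\<close> on \<open>E\<close> are relevant.
\<close>

locale cylindrical_network =
  fixes A B m :: real
    and V :: "point set" and E :: "(point \<times> point) set"
    and wt :: "point \<times> point \<Rightarrow> 'k::field_char_0"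
  assumes strip_nonempty: "A < B"
    and shift_pos: "m > 0"
    and verts_strip: "V \<subseteq> strip A B"
    and discrete_verts: "discrete V"
    and shift_verts: "(\<lambda>v. v + (m, 0)) ` V = V"
    and edges: "E \<subseteq> V \<times> V"
    and shift_edges: "\<And>u v. (u, v) \<in> E \<Longrightarrow> (u + (m, 0), v + (m, 0)) \<in> E"
    and shift_wt: "\<And>u v. (u, v) \<in> E \<Longrightarrow> wt (u + (m, 0), v + (m, 0)) = wt (u, v)"
    and finite_in: "\<And>v. v \<in> V \<Longrightarrow> finite {e \<in> E. snd e = v}"
    and finite_out: "\<And>v. v \<in> V \<Longrightarrow> finite {e \<in> E. fst e = v}"
    and acyclic: "\<And>v p (l::int). pre_digraph.awalk (cover_graph V E) v p (v + of_int l *\<^sub>R (m, 0))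
                    \<Longrightarrow> p \<noteq> [] \<Longrightarrow> l > 0"
    and finite_projection: "fin_digraph (projection (m, 0) V E)"

definition edge_weight :: "(point \<times> point \<Rightarrow> 'k) \<Rightarrow> (point \<times> point) set \<Rightarrow> 'k" where
  "edge_weight wt c = the_elem (wt ` c)"

text \<open>
  A simple cycle is identified with its set of edges; this forgets precisely the starting vertex,
  so that each cycle is counted once.
\<close>

definition simple_cycles ::
  "point \<Rightarrow> point set \<Rightarrow> (point \<times> point) set \<Rightarrow> (point \<times> point) set set set" where
  "simple_cycles g V E = {set es |es. pre_digraph.cycle (projection g V E) es}"

definition cycle_verts ::
  "point \<Rightarrow> point set \<Rightarrow> (point \<times> point) set \<Rightarrow> (point \<times> point) set set \<Rightarrow> point set set" where
  "cycle_verts g V E C = tail (projection g V E) ` C"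

definition cycle_weight :: "(point \<times> point \<Rightarrow> 'k::comm_monoid_mult) \<Rightarrow> (point \<times> point) set set \<Rightarrow> 'k"
  where "cycle_weight wt C = (\<Prod>c\<in>C. edge_weight wt c)"

text \<open>\<open>p\<close> is a path in the cover from \<open>w\<close> to \<open>w'\<close> that goes around the cycle \<open>C\<close> exactly once.\<close>

definition is_lift ::
  "point \<Rightarrow> point set \<Rightarrow> (point \<times> point) set \<Rightarrow> (point \<times> point) set set \<Rightarrow>
    point \<Rightarrow> (point \<times> point) list \<Rightarrow> point \<Rightarrow> bool" where
  "is_lift g V E C w p w' \<longleftrightarrow>
    pre_digraph.awalk (cover_graph V E) w p w' \<and>
    pre_digraph.cycle (projection g V E) (map (edge_class g E) p) \<and>
    set (map (edge_class g E) p) = C"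

definition cycle_wind ::
  "point \<Rightarrow> point set \<Rightarrow> (point \<times> point) set \<Rightarrow> (point \<times> point) set set \<Rightarrow> int" where
  "cycle_wind g V E C = (THE l. \<forall>w p w'. is_lift g V E C w p w' \<longrightarrow> w' = w + of_int l *\<^sub>R g)"

definition r_cycles ::
  "point \<Rightarrow> point set \<Rightarrow> (point \<times> point) set \<Rightarrow> nat \<Rightarrow> (point \<times> point) set set set set" where
  "r_cycles g V E r =
    {Cs. finite Cs \<and> card Cs = r \<and> Cs \<subseteq> simple_cycles g V E \<and>
         pairwise (\<lambda>C D. cycle_verts g V E C \<inter> cycle_verts g V E D = {}) Cs}"

definition multi_weight ::
  "(point \<times> point \<Rightarrow> 'k::comm_monoid_mult) \<Rightarrow> (point \<times> point) set set set \<Rightarrow> 'k" where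
  "multi_weight wt Cs = (\<Prod>C\<in>Cs. cycle_weight wt C)"

definition multi_wind ::
  "point \<Rightarrow> point set \<Rightarrow> (point \<times> point) set \<Rightarrow> (point \<times> point) set set set \<Rightarrow> int" where
  "multi_wind g V E Cs = (\<Sum>C\<in>Cs. cycle_wind g V E C)"

definition max_wind :: "point \<Rightarrow> point set \<Rightarrow> (point \<times> point) set \<Rightarrow> int" where
  "max_wind g V E = Max (multi_wind g V E ` (\<Union>r. r_cycles g V E r))"

text \<open>
  The outer sum runs over the finitely many \<open>r\<close> that contribute at all.  The argument of \<open>nat\<close>
  is nonnegative because \<open>max_wind\<close> is the maximal winding number.
\<close>

definition Q_poly ::
  "point \<Rightarrow> point set \<Rightarrow> (point \<times> point) set \<Rightarrow> (point \<times> point \<Rightarrow> 'k) \<Rightarrow> 'k::field_char_0 poly" where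
  "Q_poly g V E wt =
    (\<Sum>r | r_cycles g V E r \<noteq> {}. smult ((-1) powi (max_wind g V E - int r))
      (\<Sum>Cs\<in>r_cycles g V E r.
        monom (multi_weight wt Cs) (nat (max_wind g V E - multi_wind g V E Cs))))"

definition path_sum ::
  "point set \<Rightarrow> (point \<times> point) set \<Rightarrow> (point \<times> point \<Rightarrow> 'k::field_char_0) \<Rightarrow> point \<Rightarrow> point \<Rightarrow> 'k" where
  "path_sum V E wt u v =
    (\<Sum>p | pre_digraph.awalk (cover_graph V E) u p v. prod_list (map wt p))"

text \<open>
  Besides monic polynomials, those with leading coefficient \<open>-1\<close> are admitted, since \<open>Q_poly\<close>
  has leading coefficient \<open>(-1)\<close> to the power \<open>max_wind\<close>; the sign does not affect the recurrence.
\<close>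

definition linear_recurrence :: "'k::field_char_0 poly \<Rightarrow> (nat \<Rightarrow> 'k) \<Rightarrow> bool" where
  "linear_recurrence Q f \<longleftrightarrow>
    lead_coeff Q \<in> {1, -1} \<and> (\<forall>\<^sub>\<infinity>n. (\<Sum>i\<le>degree Q. coeff Q i * f (n + i)) = 0)"


lemma equiv_translates: "equiv X (translates g X)"
proof (rule equivI)
  show "translates g X \<subseteq> X \<times> X"
    by (auto simp: translates_def)
  show "refl_on X (translates g X)"
    by (auto simp: refl_on_def translates_def intro!: exI[of _ 0])
  show "sym (translates g X)"
  proof (rule symI)
    fix x y assume "(x, y) \<in> translates g X"
    then obtain k :: int where "x \<in> X" "y \<in> X" "y = x + of_int k *\<^sub>R g"
      by (auto simp: translates_def)
    then have "x = y + of_int (- k) *\<^sub>R g"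
      by simp
    with \<open>x \<in> X\<close> \<open>y \<in> X\<close> show "(y, x) \<in> translates g X"
      unfolding translates_def by blast
  qed
  show "trans (translates g X)"
  proof (rule transI)
    fix x y z assume "(x, y) \<in> translates g X" "(y, z) \<in> translates g X"
    then obtain k l :: int where "x \<in> X" "z \<in> X" "y = x + of_int k *\<^sub>R g" "z = y + of_int l *\<^sub>R g"
      by (auto simp: translates_def)
    then have "z = x + of_int (k + l) *\<^sub>R g"
      by (simp add: scaleR_add_left)
    with \<open>x \<in> X\<close> \<open>z \<in> X\<close> show "(x, z) \<in> translates g X"
      unfolding translates_def by blast
  qed
qed

lemma shift_int_closed:
  fixes X :: "'a::real_vector set"
  assumes "\<And>x. x \<in> X \<Longrightarrow> x + g \<in> X" "\<And>x. x \<in> X \<Longrightarrow> x - g \<in> X" "x \<in> X"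
  shows "x + of_int k *\<^sub>R g \<in> X"
proof (induction k rule: int_induct[where k = 0])
  case base
  then show ?case using assms(3) by simp
next
  case (step1 i)
  have "x + of_int (i + 1) *\<^sub>R g = (x + of_int i *\<^sub>R g) + g"
    by (simp add: scaleR_add_left)
  with assms(1)[OF step1(2)] show ?case by (simp only:)
next
  case (step2 i)
  have "x + of_int (i - 1) *\<^sub>R g = (x + of_int i *\<^sub>R g) - g"
    by (simp add: scaleR_diff_left)
  with assms(2)[OF step2(2)] show ?case by (simp only:)
qed

lemma fin_digraph_projection:
  fixes V :: "point set"
  assumes "m > 0" "V \<subseteq> strip A B" "\<forall>x\<in>strip A B. \<not> x islimpt V"
    and shift_V: "(\<lambda>v. v + (m, 0)) ` V = V"
    and "E \<subseteq> V \<times> V"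
    and shift_E: "\<And>u v. (u, v) \<in> E \<longleftrightarrow> (u + (m, 0), v + (m, 0)) \<in> E"
    and finite_out: "\<And>v. v \<in> V \<Longrightarrow> finite {e \<in> E. fst e = v}"
  shows "fin_digraph (projection (m, 0) V E)"
proof -
  define g :: point where "g = (m, 0)"
  define F where "F = V \<inter> ({0..m} \<times> {A..B})"
  have "finite F"
  proof (rule ccontr)
    assume "infinite F"
    moreover have "compact ({0..m} \<times> {A..B})"
      by (intro compact_Times) auto
    moreover have "F \<subseteq> {0..m} \<times> {A..B}"
      by (auto simp: F_def)
    ultimately obtain x where "x \<in> {0..m} \<times> {A..B}" "x islimpt F"
      using Heine_Borel_imp_Bolzano_Weierstrass[of "{0..m} \<times> {A..B}" F] by blast
    moreover have "F \<subseteq> V" by (auto simp: F_def)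
    ultimately have "x \<in> strip A B" "x islimpt V"
      by (auto simp: strip_def intro: islimpt_subset)
    with assms(3) show False by blast
  qed
  have V_plus: "v + g \<in> V" if "v \<in> V" for v
    using shift_V that by (auto simp: g_def)
  have V_minus: "v - g \<in> V" if v: "v \<in> V" for v
  proof -
    obtain w where "w \<in> V" "v = w + g"
      using shift_V v unfolding g_def by blast
    then show ?thesis by simp
  qed
  have E_plus: "e + (g, g) \<in> E" if "e \<in> E" for e
    using that iffD1[OF shift_E, of "fst e" "snd e"] by (cases e) (simp add: g_def)
  have E_minus: "e - (g, g) \<in> E" if "e \<in> E" for e
  proof -
    obtain u v where e: "e = (u, v)" by (rule prod.exhaust)
    have "((u - g) + (m, 0), (v - g) + (m, 0)) \<in> E"
      using that e by (simp add: g_def)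
    then have "(u - g, v - g) \<in> E"
      by (rule iffD2[OF shift_E])
    then show ?thesis by (simp add: e)
  qed
  have rep: "\<exists>k::int. v + of_int k *\<^sub>R g \<in> F" if v: "v \<in> V" for v
  proof -
    obtain x y where xy: "v = (x, y)" by (rule prod.exhaust)
    define k :: int where "k = - \<lfloor>x / m\<rfloor>"
    have "of_int \<lfloor>x / m\<rfloor> \<le> x / m" "x / m < of_int \<lfloor>x / m\<rfloor> + 1"
      by linarith+
    then have "of_int \<lfloor>x / m\<rfloor> * m \<le> x" "x < (of_int \<lfloor>x / m\<rfloor> + 1) * m"
      by (simp_all only: pos_le_divide_eq[OF \<open>m > 0\<close>] pos_divide_less_eq[OF \<open>m > 0\<close>])
    moreover have "A \<le> y" "y \<le> B"
      using v \<open>V \<subseteq> strip A B\<close> by (auto simp: xy strip_def)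
    moreover have "v + of_int k *\<^sub>R g \<in> V"
      using shift_int_closed[of V g v k] V_plus V_minus v by blast
    ultimately have "v + of_int k *\<^sub>R g \<in> F"
      by (auto simp: F_def xy g_def k_def algebra_simps)
    then show ?thesis ..
  qed
  have finV: "finite (V // translates g V)"
  proof (rule finite_subset)
    show "V // translates g V \<subseteq> (\<lambda>v. translates g V `` {v}) ` F"
    proof
      fix c assume "c \<in> V // translates g V"
      then obtain v where v: "v \<in> V" "c = translates g V `` {v}"
        by (auto simp: quotient_def)
      from rep[OF v(1)] obtain k :: int where k: "v + of_int k *\<^sub>R g \<in> F" ..
      then have "(v, v + of_int k *\<^sub>R g) \<in> translates g V"
        using v by (auto simp: translates_def F_def)
      then have "c = translates g V `` {v + of_int k *\<^sub>R g}"
        using v equiv_class_eq[OF equiv_translates] by blast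
      with k show "c \<in> (\<lambda>v. translates g V `` {v}) ` F" by blast
    qed
  qed (use \<open>finite F\<close> in auto)
  have finE: "finite (E // translates (g, g) E)"
  proof (rule finite_subset)
    let ?R = "\<Union>v\<in>F. {e \<in> E. fst e = v}"
    show "E // translates (g, g) E \<subseteq> (\<lambda>e. translates (g, g) E `` {e}) ` ?R"
    proof
      fix c assume "c \<in> E // translates (g, g) E"
      then obtain e where e: "e \<in> E" "c = translates (g, g) E `` {e}"
        by (auto simp: quotient_def)
      have "fst e \<in> V" using e \<open>E \<subseteq> V \<times> V\<close> by auto
      from rep[OF this] obtain k :: int where k: "fst e + of_int k *\<^sub>R g \<in> F" ..
      let ?e = "e + of_int k *\<^sub>R (g, g)"
      have "?e \<in> E"
        using shift_int_closed[of E "(g, g)" e k] E_plus E_minus e(1) by blast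
      then have "(e, ?e) \<in> translates (g, g) E"
        using e by (auto simp: translates_def)
      then have "c = translates (g, g) E `` {?e}"
        using e equiv_class_eq[OF equiv_translates] by blast
      moreover have "?e \<in> ?R"
        using \<open>?e \<in> E\<close> k by simp
      ultimately show "c \<in> (\<lambda>e. translates (g, g) E `` {e}) ` ?R" by blast
    qed
    have "F \<subseteq> V" by (auto simp: F_def)
    then show "finite ((\<lambda>e. translates (g, g) E `` {e}) ` ?R)"
      using \<open>finite F\<close> finite_out by blast
  qed
  have ends: "translates g V `` (h ` c) \<in> V // translates g V"
    if c: "c \<in> E // translates (g, g) E"
      and h: "h = fst \<or> h = snd" for c and h :: "point \<times> point \<Rightarrow> point"
  proof -
    obtain e where e: "e \<in> E" "c = translates (g, g) E `` {e}"
      using c by (auto simp: quotient_def)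
    have hE: "h e' \<in> V" if "e' \<in> E" for e'
      using h that \<open>E \<subseteq> V \<times> V\<close> by auto
    have "e \<in> c"
      using e equiv_class_self[OF equiv_translates] by blast
    have "(h e, h e') \<in> translates g V" if e': "e' \<in> c" for e'
    proof -
      obtain k :: int where "e' \<in> E" "e' = e + of_int k *\<^sub>R (g, g)"
        using e' unfolding e(2) translates_def by blast
      then have "h e' = h e + of_int k *\<^sub>R g"
        using h by auto
      then show ?thesis
        using hE e(1) \<open>e' \<in> E\<close> unfolding translates_def by blast
    qed
    then have "translates g V `` {h e'} = translates g V `` {h e}" if "e' \<in> c" for e'
      using that equiv_class_eq[OF equiv_translates] by blast
    then have "translates g V `` (h ` c) = translates g V `` {h e}"
      using \<open>e \<in> c\<close> by blast
    then show ?thesis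
      using hE[OF e(1)] by (simp add: quotientI)
  qed
  show ?thesis
    unfolding g_def[symmetric]
    by unfold_locales (use finV finE ends in \<open>auto simp: projection_def\<close>)
qed

end

(*
  Attach to each arc c of the projection the Laurent monomial w c = wt(c) X^s, where s is the number
  of translations by g that c advances, and to each vertex class a the Laurent series
  H a = sum over n of N(u, a_n) X^n.  Splitting off the last edge of a path gives
  H b = q b + (sum over arcs c into b of w c * H (tail c)), where q b has only finitely many nonzero
  terms.  Let D W be the sum over all collections of disjoint simple cycles inside W of the product
  of the terms -w(C).  Then D V * H b is the sum over all simple paths P from some a to b of
  w(P) * D (V - P) * q a, a kind of Cramer's rule, so D V * H b has only finitely many nonzero terms.
  Up to sign and reversal of the exponents D V is Q_N, so this is the recurrence.
*)

theory Submission
  imports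
    Defs
    "HOL-Computational_Algebra.Formal_Laurent_Series"
begin

section \<open>Packings of disjoint cycles\<close>

text \<open>A vertex class has no canonical origin, so the shift of a single arc depends on chosen
  representatives and may be negative; hence Laurent monomials rather than polynomials. Only around
  closed walks is the shift intrinsic, and there acyclicity makes it positive. This positivity also
  bounds the shift of every walk from below: cutting out closed pieces lowers the shift, and what is
  left repeats no arc. So path sums are finite, and each H a has only finitely many terms of
  negative exponent.

  The edge set is closed under translation by g but possibly not by -g, so a walk of the projection
  is only known to lift if it starts far enough to the right. The equation for H b can therefore
  fail at low positions; together with the empty path these failures make up q b.

  The identity for D V * H b is obtained by cancellation, without determinants. Its core is an
  exchange at the start of a simple path: that vertex may belong to the path or be handed back to
  the cycles. Summing over all simple paths with the start handed back, and evaluating this sum in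
  two ways, gives the formula.\<close>

context pre_digraph
begin

definition cycle_sets :: "'b set set" where
  "cycle_sets = {set es |es. cycle es}"

text \<open>A cycle leaves each of its vertices by exactly one arc, so the tails of \<open>C\<close>
  are its vertex set.\<close>

definition packings :: "'a set \<Rightarrow> 'b set set set" where
  "packings W = {Cs. Cs \<subseteq> cycle_sets \<and> pairwise (\<lambda>C D. tail G ` C \<inter> tail G ` D = {}) Cs \<and>
     (\<forall>C\<in>Cs. tail G ` C \<subseteq> W)}"

text \<open>If M is the matrix whose entries sum \<open>w\<close> over the arcs between two
  vertices, this is the principal minor of 1 - M on \<open>W\<close>: in the expansion over
  permutations a cycle of length n has sign (-1)^(n-1) and n factors from -M, which leaves one minus
  sign per cycle.\<close>

definition packing_sum :: "('b \<Rightarrow> 'r::comm_ring_1) \<Rightarrow> 'a set \<Rightarrow> 'r" where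
  "packing_sum w W = (\<Sum>Cs\<in>packings W. \<Prod>C\<in>Cs. - (\<Prod>e\<in>C. w e))"

text \<open>A cycle through \<open>c\<close>, cut open at \<open>c\<close>: its first arc and a
  simple path back. The vertices of that path, \<open>c\<close> included, are those of the cycle,
  and the path can be glued to another one starting at \<open>c\<close>.\<close>

definition cycles_at :: "'a \<Rightarrow> ('b \<times> 'b list) set" where
  "cycles_at c = {(e, p). e \<in> arcs G \<and> tail G e = c \<and> apath (head G e) p c}"

definition apaths_to :: "'a \<Rightarrow> ('a \<times> 'b list) set" where
  "apaths_to b = {(a, p). apath a p b}"

end

section \<open>Cycles with a marked vertex\<close>

context wf_digraph
begin

lemma awalk_verts_eq_tails: "awalk u p v \<Longrightarrow> awalk_verts u p = map (tail G) p @ [v]"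
  by (induction p arbitrary: u) (auto simp: awalk_simps)

text \<open>In a closed walk, omitting the first or the last vertex leaves the same vertices; the
  second choice gives the tails.\<close>

lemma cycle_iff_tails:
  "cycle es \<longleftrightarrow> es \<noteq> [] \<and> (\<exists>u. awalk u es u \<and> distinct (map (tail G) es))"
proof -
  have "distinct (tl (awalk_verts u es)) \<longleftrightarrow> distinct (map (tail G) es)"
    if "awalk u es u" "es \<noteq> []" for u
    using that by (cases es) (auto simp: awalk_verts_eq_tails awalk_simps)
  then show ?thesis
    unfolding cycle_def by blast
qed

lemma cycles_at_tails:
  assumes "(e, p) \<in> cycles_at c"
  shows "tail G ` set (e # p) = set (awalk_verts (head G e) p)"
    and "distinct (map (tail G) (e # p))" and "awalk c (e # p) c"
  using assms by (auto simp: cycles_at_def apath_def awalk_verts_eq_tails awalk_simps)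

lemma cycles_at_cycle: "(e, p) \<in> cycles_at c \<Longrightarrow> cycle (e # p)"
  using cycles_at_tails(2,3) unfolding cycle_iff_tails by blast

text \<open>At most one arc of \<open>Z\<close> leaves any given vertex, so a walk inside
  \<open>Z\<close> is forced by its start and length.\<close>

lemma cas_determined:
  assumes "length p = length q" "cas u p v" "cas u q v'"
    and "inj_on (tail G) Z" "set p \<subseteq> Z" "set q \<subseteq> Z"
  shows "p = q"
  using assms
proof (induction p q arbitrary: u rule: list_induct2)
  case (Cons x xs y ys)
  then have "x = y" by (auto simp: inj_on_def)
  with Cons show ?case by auto
qed simp

lemma inj_on_cycles_at: "inj_on (\<lambda>(e, p). set (e # p)) (cycles_at c)"
proof (rule inj_onI, clarify)
  fix e p e' p'
  assume m: "(e, p) \<in> cycles_at c" "(e', p') \<in> cycles_at c" and eq: "set (e # p) = set (e' # p')"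
  have "inj_on (tail G) (set (e # p))"
    using cycles_at_tails(2)[OF m(1)] unfolding distinct_map by blast
  moreover have "distinct (e # p)" "distinct (e' # p')"
    using cycles_at_tails(2)[OF m(1)] cycles_at_tails(2)[OF m(2)] unfolding distinct_map by blast+
  then have "length (e # p) = length (e' # p')"
    using eq distinct_card by metis
  moreover have "cas c (e # p) c" "cas c (e' # p') c"
    using cycles_at_tails(3)[OF m(1)] cycles_at_tails(3)[OF m(2)] by blast+
  ultimately have "e # p = e' # p'"
    using cas_determined[of "e # p" "e' # p'" c c c "set (e # p)"] eq by blast
  then show "e = e' \<and> p = p'" by simp
qed

text \<open>Rotate the closed walk so that it begins with the arc leaving \<open>c\<close>; the part
  before that arc is moved to the end.\<close>

lemma cycle_sets_rotate:
  assumes "C \<in> cycle_sets" "c \<in> tail G ` C"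
  shows "\<exists>(e, p)\<in>cycles_at c. set (e # p) = C"
proof -
  from assms(1) obtain es u where es: "C = set es" "awalk u es u" "distinct (map (tail G) es)"
    unfolding cycle_sets_def cycle_iff_tails by blast
  from assms(2) obtain e where e: "e \<in> set es" "c = tail G e"
    unfolding es by blast
  then obtain q r where qr: "es = q @ e # r"
    by (meson split_list)
  have "awalk u q c" "awalk (head G e) r u" "e \<in> arcs G"
    using es(2) e(2) unfolding qr by (auto simp: awalk_simps)
  then have w: "awalk (head G e) (r @ q) c"
    by (blast intro: awalk_appendI)
  then have "distinct (awalk_verts (head G e) (r @ q))"
    unfolding awalk_verts_eq_tails[OF w] using es(3) by (auto simp: qr e(2))
  with w \<open>e \<in> arcs G\<close> have "(e, r @ q) \<in> cycles_at c"
    by (simp add: cycles_at_def e(2) apath_def)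
  moreover have "set (e # r @ q) = C"
    unfolding es(1) qr by auto
  ultimately show ?thesis by blast
qed

lemma bij_betw_cycles_at:
  "bij_betw (\<lambda>(e, p). set (e # p))
     {(e, p) \<in> cycles_at c. set (awalk_verts (head G e) p) \<subseteq> W}
     {C \<in> cycle_sets. c \<in> tail G ` C \<and> tail G ` C \<subseteq> W}"
proof (rule bij_betwI')
  fix x y
  assume "x \<in> {(e, p) \<in> cycles_at c. set (awalk_verts (head G e) p) \<subseteq> W}"
    "y \<in> {(e, p) \<in> cycles_at c. set (awalk_verts (head G e) p) \<subseteq> W}"
  then show "((case x of (e, p) \<Rightarrow> set (e # p)) = (case y of (e, p) \<Rightarrow> set (e # p))) = (x = y)"
    using inj_on_cycles_at[of c] by (auto simp: inj_on_def)
next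
  fix x assume "x \<in> {(e, p) \<in> cycles_at c. set (awalk_verts (head G e) p) \<subseteq> W}"
  then obtain e p where x: "x = (e, p)" "(e, p) \<in> cycles_at c" "set (awalk_verts (head G e) p) \<subseteq> W"
    by blast
  have "c \<in> tail G ` set (e # p)" using x(2) by (simp add: cycles_at_def)
  then show "(case x of (e, p) \<Rightarrow> set (e # p)) \<in> {C \<in> cycle_sets. c \<in> tail G ` C \<and> tail G ` C \<subseteq> W}"
    using x cycles_at_cycle[OF x(2)] cycles_at_tails(1)[OF x(2)]
    by (auto simp: cycle_sets_def simp del: list.set intro!: exI[of _ "e # p"])
next
  fix C assume C: "C \<in> {C \<in> cycle_sets. c \<in> tail G ` C \<and> tail G ` C \<subseteq> W}"
  then obtain e p where ep: "(e, p) \<in> cycles_at c" "set (e # p) = C"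
    using cycle_sets_rotate[of C c] by blast
  then show "\<exists>x\<in>{(e, p) \<in> cycles_at c. set (awalk_verts (head G e) p) \<subseteq> W}.
      C = (case x of (e, p) \<Rightarrow> set (e # p))"
    using C cycles_at_tails(1)[OF ep(1)] by (intro bexI[of _ "(e, p)"]) auto
qed

lemma cycle_sets_arcs: "C \<in> cycle_sets \<Longrightarrow> C \<subseteq> arcs G"
  by (auto simp: cycle_sets_def cycle_iff_tails awalk_def)

lemma cycle_prod_split:
  "(e, p) \<in> cycles_at c \<Longrightarrow> (\<Prod>x\<in>set (e # p). w x) = w e * prod_list (map w p)"
  using cycles_at_tails(2)[of e p c] prod.distinct_set_conv_list[of "e # p" w] unfolding distinct_map by simp

end

section \<open>Expanding the packing sum at a vertex\<close>

context fin_digraph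
begin

lemma finite_cycle_sets: "finite cycle_sets"
  by (rule finite_subset[of _ "Pow (arcs G)"]) (auto dest: cycle_sets_arcs)

lemma finite_packings: "finite (packings W)"
  by (rule finite_subset[of _ "Pow cycle_sets"]) (auto simp: packings_def finite_cycle_sets)

lemma finite_packing: "Cs \<in> packings W \<Longrightarrow> finite Cs"
  using finite_cycle_sets finite_subset by (auto simp: packings_def)

text \<open>A packing either avoids \<open>c\<close> or has exactly one cycle through
  \<open>c\<close>. Deleting that cycle leaves an arbitrary packing of the vertices off the cycle,
  and costs one factor with a minus sign.\<close>

lemma packing_sum_remove_cycles:
  assumes "c \<in> W"
  shows "packing_sum w W = packing_sum w (W - {c}) -
    (\<Sum>C | C \<in> cycle_sets \<and> c \<in> tail G ` C \<and> tail G ` C \<subseteq> W.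
       (\<Prod>e\<in>C. w e) * packing_sum w (W - tail G ` C))"
proof -
  let ?K = "{C. C \<in> cycle_sets \<and> c \<in> tail G ` C \<and> tail G ` C \<subseteq> W}"
  let ?F = "\<lambda>Cs. \<Prod>C\<in>Cs. - (\<Prod>e\<in>C. w e)"
  let ?S = "SIGMA C:?K. packings (W - tail G ` C)"
  have sub: "packings (W - {c}) \<subseteq> packings W"
    by (auto simp: packings_def)
  have notin: "C \<notin> Cs" if "C \<in> ?K" "Cs \<in> packings (W - tail G ` C)" for C Cs
    using that unfolding packings_def by blast
  have bij: "bij_betw (\<lambda>(C, Cs). insert C Cs) ?S (packings W - packings (W - {c}))"
  \<comment> \<open>By disjointness the cycle through \<open>c\<close> is unique, so the inverse can
    name it by a definite description.\<close>
  proof (rule bij_betw_byWitness[where f' = "\<lambda>Cs. let C = (THE C. C \<in> Cs \<and> c \<in> tail G ` C) in (C, Cs - {C})"])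
    have the: "(THE C. C \<in> insert D Cs \<and> c \<in> tail G ` C) = D"
      if "D \<in> ?K" "Cs \<in> packings (W - tail G ` D)" for D Cs
      using that unfolding packings_def by (intro the_equality) blast+
    show "\<forall>a\<in>?S. (let C = (THE C. C \<in> (case a of (C, Cs) \<Rightarrow> insert C Cs) \<and> c \<in> tail G ` C)
        in (C, (case a of (C, Cs) \<Rightarrow> insert C Cs) - {C})) = a"
    proof
      fix a assume "a \<in> ?S"
      then obtain D Cs where a: "a = (D, Cs)" "D \<in> ?K" "Cs \<in> packings (W - tail G ` D)" by blast
      show "(let C = (THE C. C \<in> (case a of (C, Cs) \<Rightarrow> insert C Cs) \<and> c \<in> tail G ` C)
        in (C, (case a of (C, Cs) \<Rightarrow> insert C Cs) - {C})) = a"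
        unfolding a(1) prod.case the[OF a(2,3)] Let_def using notin[OF a(2,3)] by simp
    qed
    have ex: "\<exists>D\<in>?K. D \<in> Cs \<and> Cs - {D} \<in> packings (W - tail G ` D) \<and> (THE C. C \<in> Cs \<and> c \<in> tail G ` C) = D"
      if Cs: "Cs \<in> packings W - packings (W - {c})" for Cs
    proof -
      have pw: "pairwise (\<lambda>C D. tail G ` C \<inter> tail G ` D = {}) Cs"
        using Cs by (auto simp: packings_def)
      obtain D where D: "D \<in> Cs" "c \<in> tail G ` D"
        using Cs unfolding packings_def by blast
      have *: "tail G ` C \<inter> tail G ` D = {}" if "C \<in> Cs - {D}" for C
        using pw D(1) that unfolding pairwise_def by blast
      have "D \<in> ?K" using Cs D by (auto simp: packings_def)
      moreover have "Cs - {D} \<in> packings (W - tail G ` D)"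
      proof -
        have "pairwise (\<lambda>C D. tail G ` C \<inter> tail G ` D = {}) (Cs - {D})"
          using pw by (rule pairwise_subset) auto
        moreover have "tail G ` C \<subseteq> W - tail G ` D" if "C \<in> Cs - {D}" for C
          using *[OF that] that Cs unfolding packings_def by blast
        ultimately show ?thesis using Cs unfolding packings_def by blast
      qed
      moreover have "(THE C. C \<in> Cs \<and> c \<in> tail G ` C) = D"
        using * D by (intro the_equality) blast+
      ultimately show ?thesis using D(1) by blast
    qed
    show "\<forall>Cs\<in>packings W - packings (W - {c}). (case (let C = (THE C. C \<in> Cs \<and> c \<in> tail G ` C) in (C, Cs - {C}))
       of (C, Cs) \<Rightarrow> insert C Cs) = Cs"
    proof
      fix Cs assume "Cs \<in> packings W - packings (W - {c})"
      from ex[OF this] obtain D where "D \<in> Cs" "(THE C. C \<in> Cs \<and> c \<in> tail G ` C) = D" by blast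
      then show "(case (let C = (THE C. C \<in> Cs \<and> c \<in> tail G ` C) in (C, Cs - {C}))
       of (C, Cs) \<Rightarrow> insert C Cs) = Cs" by (auto simp: Let_def)
    qed
    show "(\<lambda>Cs. let C = (THE C. C \<in> Cs \<and> c \<in> tail G ` C) in (C, Cs - {C})) ` (packings W - packings (W - {c})) \<subseteq> ?S"
    proof (rule image_subsetI)
      fix Cs assume "Cs \<in> packings W - packings (W - {c})"
      from ex[OF this] obtain D where "D \<in> ?K" "Cs - {D} \<in> packings (W - tail G ` D)"
        "(THE C. C \<in> Cs \<and> c \<in> tail G ` C) = D" by blast
      then show "(let C = (THE C. C \<in> Cs \<and> c \<in> tail G ` C) in (C, Cs - {C})) \<in> ?S" by (simp add: Let_def)
    qed
    show "(\<lambda>(C, Cs). insert C Cs) ` ?S \<subseteq> packings W - packings (W - {c})"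
    proof (rule image_subsetI)
      fix x assume "x \<in> ?S"
      then obtain C Cs where x: "x = (C, Cs)" "C \<in> ?K" "Cs \<in> packings (W - tail G ` C)" by blast
      have Cs: "Cs \<subseteq> cycle_sets" "pairwise (\<lambda>C D. tail G ` C \<inter> tail G ` D = {}) Cs"
        "\<forall>D\<in>Cs. tail G ` D \<subseteq> W - tail G ` C"
        using x(3) by (auto simp: packings_def)
      then have "\<forall>D\<in>Cs. tail G ` C \<inter> tail G ` D = {} \<and> tail G ` D \<inter> tail G ` C = {} \<and> tail G ` D \<subseteq> W"
        by blast
      then have "insert C Cs \<in> packings W"
        using x(2) Cs(1,2) by (simp add: packings_def pairwise_insert)
      moreover have "insert C Cs \<notin> packings (W - {c})"
        using x(2) unfolding packings_def by blast
      ultimately show "(case x of (C, Cs) \<Rightarrow> insert C Cs) \<in> packings W - packings (W - {c})"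
        using x(1) by simp
    qed
  qed
  have "packing_sum w W = packing_sum w (W - {c}) + (\<Sum>Cs\<in>packings W - packings (W - {c}). ?F Cs)"
    unfolding packing_sum_def using sum.subset_diff[OF sub finite_packings, of ?F] by (simp add: add.commute)
  also have "(\<Sum>Cs\<in>packings W - packings (W - {c}). ?F Cs) = (\<Sum>(C, Cs)\<in>?S. ?F (insert C Cs))"
    by (subst sum.reindex_bij_betw[OF bij, symmetric]) (simp add: case_prod_beta)
  also have "\<dots> = (\<Sum>(C, Cs)\<in>?S. - (\<Prod>e\<in>C. w e) * ?F Cs)"
  proof (rule sum.cong[OF refl])
    fix x assume "x \<in> ?S"
    then obtain C Cs where x: "x = (C, Cs)" "C \<in> ?K" "Cs \<in> packings (W - tail G ` C)" by blast
    then show "(case x of (C, Cs) \<Rightarrow> ?F (insert C Cs)) = (case x of (C, Cs) \<Rightarrow> - (\<Prod>e\<in>C. w e) * ?F Cs)"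
      using finite_packing[OF x(3)] notin[OF x(2,3)] by simp
  qed
  also have "\<dots> = (\<Sum>C\<in>?K. \<Sum>Cs\<in>packings (W - tail G ` C). - (\<Prod>e\<in>C. w e) * ?F Cs)"
    by (rule sum.Sigma[symmetric]) (auto simp: finite_cycle_sets finite_packings)
  also have "\<dots> = - (\<Sum>C\<in>?K. (\<Prod>e\<in>C. w e) * packing_sum w (W - tail G ` C))"
    unfolding packing_sum_def by (simp add: sum_distrib_left sum_negf)
  finally show ?thesis by simp
qed

text \<open>The expansion in terms of opened cycles, the form in which a cycle can be attached to
  the start of a simple path.\<close>

lemma packing_sum_remove:
  assumes "c \<in> W"
  shows "packing_sum w W = packing_sum w (W - {c}) -
    (\<Sum>(e, p) | (e, p) \<in> cycles_at c \<and> set (awalk_verts (head G e) p) \<subseteq> W.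
       w e * prod_list (map w p) * packing_sum w (W - set (awalk_verts (head G e) p)))"
proof -
  have "(\<Sum>C | C \<in> cycle_sets \<and> c \<in> tail G ` C \<and> tail G ` C \<subseteq> W.
       (\<Prod>e\<in>C. w e) * packing_sum w (W - tail G ` C)) =
    (\<Sum>(e, p) | (e, p) \<in> cycles_at c \<and> set (awalk_verts (head G e) p) \<subseteq> W.
       w e * prod_list (map w p) * packing_sum w (W - set (awalk_verts (head G e) p)))"
    by (subst sum.reindex_bij_betw[OF bij_betw_cycles_at, symmetric], rule sum.cong)
       (auto simp: cycles_at_tails(1)[symmetric] cycle_prod_split[symmetric] simp del: list.set)
  then show ?thesis
    using packing_sum_remove_cycles[OF assms, of w] by (simp only:)
qed

section \<open>Cramer's rule by exchanging vertices between paths and cycles\<close>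

lemma finite_apaths_to: "finite (apaths_to b)"
proof (rule finite_subset)
  show "apaths_to b \<subseteq> verts G \<times> {p. distinct p \<and> set p \<subseteq> arcs G}"
    using distinct_verts_imp_distinct by (auto simp: apaths_to_def apath_def awalk_hd_in_verts)
  show "finite (verts G \<times> {p. distinct p \<and> set p \<subseteq> arcs G})"
    using finite_subset_distinct[OF finite_arcs] by (simp add: conj_commute)
qed

lemma finite_cycles_at: "finite (cycles_at c)"
  by (rule finite_subset[of _ "arcs G \<times> snd ` apaths_to c"])
     (use finite_apaths_to in \<open>force simp: cycles_at_def apaths_to_def\<close>)+

text \<open>
  Expand \<open>h a\<close> in the sum over the simple paths.  An arc whose tail is off the path yields a longer
  path (\<open>?T1\<close>); one whose tail is on the path closes a cycle attached to a shorter path (\<open>?T2\<close>), and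
  these terms cancel the cycle terms of \<open>packing_sum_remove\<close> applied at the start of the shorter path.
\<close>

lemma packing_sum_mult_solution:
  fixes w :: "'b \<Rightarrow> 'r::comm_ring_1"
  assumes h: "\<And>b. b \<in> verts G \<Longrightarrow> h b = q b + (\<Sum>e | e \<in> arcs G \<and> head G e = b. w e * h (tail G e))"
    and b: "b \<in> verts G"
  shows "packing_sum w (verts G) * h b =
    (\<Sum>(a, p)\<in>apaths_to b. prod_list (map w p) * packing_sum w (verts G - set (awalk_verts a p)) * q a)"
proof -
  let ?D = "packing_sum w" and ?AP = "apaths_to b"
  let ?v = awalk_verts
  let ?U = "\<lambda>a p. verts G - set (awalk_verts a p)"
  let ?wl = "\<lambda>p. prod_list (map w p)"
  define S where "S = (\<Sum>(a, p)\<in>?AP. ?wl p * ?D (?U a p) * h a)"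
  define T where "T = {(p, e). e \<in> arcs G \<and> apath (head G e) p b}"
  define t where "t = (\<lambda>(p, e). ?wl p * ?D (?U (head G e) p) * (w e * h (tail G e)))"
  let ?T1 = "{(p, e) \<in> T. tail G e \<notin> set (?v (head G e) p)}"
  let ?T2 = "{(p, e) \<in> T. tail G e \<in> set (?v (head G e) p)}"
  have finT: "finite T"
    by (rule finite_subset[of _ "snd ` ?AP \<times> arcs G"])
       (use finite_apaths_to in \<open>force simp: T_def apaths_to_def\<close>)+
  have AP_vert: "a \<in> verts G" if "(a, p) \<in> ?AP" for a p
    using that by (auto simp: apaths_to_def apath_def)
  have "S = (\<Sum>(a, p)\<in>?AP. ?wl p * ?D (?U a p) * q a) +
      (\<Sum>(a, p)\<in>?AP. \<Sum>e | e \<in> arcs G \<and> head G e = a. ?wl p * ?D (?U a p) * (w e * h (tail G e)))"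
  proof -
    have "S = (\<Sum>(a, p)\<in>?AP. ?wl p * ?D (?U a p) * q a +
      (\<Sum>e | e \<in> arcs G \<and> head G e = a. ?wl p * ?D (?U a p) * (w e * h (tail G e))))"
      unfolding S_def
      by (rule sum.cong[OF refl]) (auto simp: h[OF AP_vert] distrib_left sum_distrib_left)
    then show ?thesis by (simp add: case_prod_unfold sum.distrib)
  qed
  also have "(\<Sum>(a, p)\<in>?AP. \<Sum>e | e \<in> arcs G \<and> head G e = a. ?wl p * ?D (?U a p) * (w e * h (tail G e))) =
      (\<Sum>y\<in>?AP. \<Sum>e | e \<in> arcs G \<and> head G e = fst y. t (snd y, e))"
    by (auto simp: t_def intro!: sum.cong)
  also have "\<dots> = (\<Sum>(y, e)\<in>(SIGMA y:?AP. {e. e \<in> arcs G \<and> head G e = fst y}). t (snd y, e))"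
    by (rule sum.Sigma) (auto simp: finite_apaths_to)
  also have "\<dots> = sum t T"
    by (rule sum.reindex_bij_witness[of _ "\<lambda>(p, e). ((head G e, p), e)" "\<lambda>x. (snd (fst x), snd x)"])
       (auto simp: T_def apaths_to_def)
  also have "sum t T = sum t ?T1 + sum t ?T2"
    by (subst sum.union_disjoint[symmetric]) (auto intro!: sum.cong finite_subset[OF _ finT])
  finally have S1: "S = (\<Sum>(a, p)\<in>?AP. ?wl p * ?D (?U a p) * q a) + (sum t ?T1 + sum t ?T2)" .

  \<comment> \<open>Unlike in \<open>S\<close>, the start of the path is returned to the vertices
    free for cycles. For a path \<open>e # p'\<close> the free vertices are then those left by
    \<open>p'\<close>, which gives the terms of \<open>?T1\<close>; the empty path gives the product
    to be computed.\<close>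
  define s where "s = (\<lambda>(a, p). ?wl p * ?D (insert a (?U a p)) * h a)"
  have "sum s ?AP = sum s {(b, [])} + sum s (?AP - {(b, [])})"
    using sum.subset_diff[of "{(b, [])}" ?AP s] finite_apaths_to b
    by (simp add: apaths_to_def apath_Nil_iff add.commute)
  also have "s (b, []) = ?D (verts G) * h b"
    using b by (simp add: s_def insert_absorb)
  then have "sum s {(b, [])} = ?D (verts G) * h b" by simp
  also have "sum s (?AP - {(b, [])}) = sum t ?T1"
  proof (rule sum.reindex_bij_witness[of _ "\<lambda>(p, e). (tail G e, e # p)" "\<lambda>(a, p). (tl p, hd p)"])
    fix x assume "x \<in> ?AP - {(b, [])}"
    then obtain a p where x: "x = (a, p)" "apath a p b" "(a, p) \<noteq> (b, [])"
      by (auto simp: apaths_to_def)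
    then obtain e p' where p: "p = e # p'"
      by (cases p) (auto simp: apath_Nil_iff)
    show "(case case x of (a, p) \<Rightarrow> (tl p, hd p) of (p, e) \<Rightarrow> (tail G e, e # p)) = x"
      "(case x of (a, p) \<Rightarrow> (tl p, hd p)) \<in> ?T1"
      using x by (auto simp: p apath_Cons_iff T_def)
    have "insert a (?U a p) = ?U (head G e) p'"
      using x(2) by (auto simp: p apath_Cons_iff)
    moreover have "tail G e = a" using x(2) by (simp add: p apath_Cons_iff)
    ultimately show "t (case x of (a, p) \<Rightarrow> (tl p, hd p)) = s x"
      by (simp add: x(1) s_def t_def) (simp add: p mult_ac)
  next
    fix y assume "y \<in> ?T1"
    then show "(case case y of (p, e) \<Rightarrow> (tail G e, e # p) of (a, p) \<Rightarrow> (tl p, hd p)) = y"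
      "(case y of (p, e) \<Rightarrow> (tail G e, e # p)) \<in> ?AP - {(b, [])}"
      by (auto simp: T_def apaths_to_def apath_Cons_iff)
  qed
  finally have S2: "sum s ?AP = ?D (verts G) * h b + sum t ?T1" .

  \<comment> \<open>Second evaluation of \<open>sum s\<close>: expand the packing sum at the start
    \<open>c\<close> of the path. The cycles that occur pass through \<open>c\<close> and otherwise
    avoid \<open>p\<close>.\<close>
  let ?Z = "\<lambda>c p. {(e, r). (e, r) \<in> cycles_at c \<and> set (?v (head G e) r) \<subseteq> insert c (?U c p)}"
  let ?z = "\<lambda>((c, p), (e, r)). ?wl p * (w e * ?wl r * ?D (insert c (?U c p) - set (?v (head G e) r))) * h c"
  have expand: "s (c, p) = ?wl p * ?D (?U c p) * h c - (\<Sum>x\<in>?Z c p. ?z ((c, p), x))"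
    if cp: "(c, p) \<in> ?AP" for c p
  proof -
    have "insert c (?U c p) - {c} = ?U c p"
      using cp hd_in_awalk_verts(2) by (auto simp: apaths_to_def)
    then have "?D (insert c (?U c p)) = ?D (?U c p) -
       (\<Sum>(e, r)\<in>?Z c p. w e * ?wl r * ?D (insert c (?U c p) - set (?v (head G e) r)))"
      using packing_sum_remove[of c "insert c (?U c p)" w] by simp
    then show ?thesis
      by (simp add: s_def right_diff_distrib left_diff_distrib sum_distrib_left sum_distrib_right case_prod_unfold)
  qed
  have "sum s ?AP = (\<Sum>y\<in>?AP. ?wl (snd y) * ?D (?U (fst y) (snd y)) * h (fst y) -
      (\<Sum>x\<in>?Z (fst y) (snd y). ?z (y, x)))"
  proof (rule sum.cong[OF refl])
    fix y assume "y \<in> ?AP"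
    with expand[of "fst y" "snd y"]
    show "s y = ?wl (snd y) * ?D (?U (fst y) (snd y)) * h (fst y) - (\<Sum>x\<in>?Z (fst y) (snd y). ?z (y, x))"
      by (simp only: prod.collapse)
  qed
  also have "\<dots> = S - (\<Sum>y\<in>?AP. \<Sum>x\<in>?Z (fst y) (snd y). ?z (y, x))"
    by (simp add: S_def sum_subtractf case_prod_unfold)
  also have "(\<Sum>y\<in>?AP. \<Sum>x\<in>?Z (fst y) (snd y). ?z (y, x)) = sum ?z (SIGMA y:?AP. ?Z (fst y) (snd y))"
    by (subst sum.Sigma) (auto simp: finite_apaths_to case_prod_unfold intro: finite_subset[OF _ finite_cycles_at])
  also have "\<dots> = sum t ?T2"
  proof -
    \<comment> \<open>Gluing \<open>r\<close> to \<open>p\<close> at \<open>c\<close> yields a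
      simple path whose vertex \<open>c\<close> is the tail of \<open>e\<close>. Conversely, a path
      with an arc \<open>e\<close> from one of its vertices into its start is cut at that
      vertex.\<close>
    let ?f = "\<lambda>((c, p), (e, r)). (r @ p, e)"
    let ?Y = "SIGMA y:?AP. ?Z (fst y) (snd y)"
    have last_eq: "awlast (head G e) r = c" if "apath (head G e) r c" for e r c
      using that by (auto simp: apath_def)
    have inj: "inj_on ?f ?Y"
    proof (rule inj_onI)
      fix x y assume "x \<in> ?Y" "y \<in> ?Y" and eq: "?f x = ?f y"
      moreover obtain c p e r c' p' e' r' where xy: "x = ((c, p), (e, r))" "y = ((c', p'), (e', r'))"
        by (metis prod.exhaust)
      ultimately have *: "apath (head G e) r c" "apath (head G e) r' c" "c' = c" "e' = e" "r @ p = r' @ p'"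
        by (auto simp: cycles_at_def)
      \<comment> \<open>A simple path visits \<open>c\<close> only once, so it has only one prefix
        ending at \<open>c\<close>; this recovers \<open>r\<close> and \<open>p\<close> from
        \<open>r @ p\<close>.\<close>
      have "z = []" if "apath (head G e) r c" "apath (head G e) (r @ z) c" for r z
        using that apath_nonempty_ends[of c z c] by (auto simp: apath_append_iff last_eq)
      then have "r = r'"
        using * by (auto simp: append_eq_append_conv2)
      with * xy show "x = y" by simp
    qed
    \<comment> \<open>The cycle meets \<open>p\<close> in \<open>c\<close> only, and
      \<open>c\<close> occurs in \<open>p\<close> just at the start, so \<open>r @ p\<close> repeats
      no vertex.\<close>
    have split: "apath (head G e) (r @ p) b \<and> c \<in> set (?v (head G e) (r @ p)) \<and>
        insert c (?U c p) - set (?v (head G e) r) = ?U (head G e) (r @ p)"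
      if "apath c p b" "apath (head G e) r c" "set (?v (head G e) r) \<subseteq> insert c (?U c p)" for c p e r
    proof -
      have *: "awalk (head G e) r c" "awalk c p b"
        using that by (auto simp: apath_def)
      have "distinct (?v c p)" "hd (?v c p) = c"
        using that(1) by (auto simp: apath_def)
      then have "c \<notin> set (tl (?v c p))"
        by (cases "?v c p") auto
      moreover have "set (tl (?v c p)) \<subseteq> set (?v c p)"
        by (meson list.set_sel(2) subsetI awalk_verts_non_Nil)
      ultimately have "set (?v (head G e) r) \<inter> set (tl (?v c p)) = {}"
        using that(3) by blast
      then have "apath (head G e) (r @ p) b"
        using that by (simp add: apath_append_iff last_eq[OF that(2)])
      moreover have "c \<in> set (?v (head G e) r)"
        using awalk_verts_eq_tails[OF *(1)] by simp
      ultimately show ?thesis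
        unfolding set_awalk_verts_append[OF *] by blast
    qed
    have "?f ` ?Y = ?T2"
    proof (intro equalityI subsetI)
      fix y assume "y \<in> ?f ` ?Y"
      then obtain c p e r where y: "y = (r @ p, e)" and "apath c p b" "(e, r) \<in> cycles_at c"
        "set (?v (head G e) r) \<subseteq> insert c (?U c p)"
        by (auto simp: apaths_to_def)
      then show "y \<in> ?T2"
        using split[of c p e r] by (auto simp: T_def cycles_at_def)
    next
      fix y assume "y \<in> ?T2"
      then obtain P e where y: "y = (P, e)" "e \<in> arcs G" "apath (head G e) P b"
        "tail G e \<in> set (?v (head G e) P)"
        by (auto simp: T_def)
      let ?c = "tail G e"
      obtain r p where rp: "P = r @ p" "awalk (head G e) r ?c" "awalk ?c p b"
        using awalk_decomp[OF awalkI_apath[OF y(3)] y(4)] by blast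
      then have last: "awlast (head G e) r = ?c" by auto
      have ap: "apath (head G e) r ?c" "apath ?c p b"
        "set (?v (head G e) r) \<inter> set (tl (?v ?c p)) = {}"
        using y(3) unfolding rp(1) apath_append_iff last by auto
      have "hd (?v ?c p) = ?c" using rp(3) by auto
      then have "set (?v ?c p) = insert ?c (set (tl (?v ?c p)))"
        by (metis awalk_verts_non_Nil list.collapse list.simps(15))
      moreover have "set (?v (head G e) r) \<subseteq> verts G" using rp(2) by auto
      ultimately have "set (?v (head G e) r) \<subseteq> insert ?c (?U ?c p)"
        using ap(3) by auto
      then have "((?c, p), (e, r)) \<in> ?Y"
        using ap y(2) by (auto simp: apaths_to_def cycles_at_def)
      moreover have "y = ?f ((?c, p), (e, r))" using y(1) rp(1) by simp
      ultimately show "y \<in> ?f ` ?Y" by blast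
    qed
    with inj have bij: "bij_betw ?f ?Y ?T2"
      by (simp add: bij_betw_def)
    show ?thesis
    proof (subst sum.reindex_bij_betw[OF bij, symmetric], rule sum.cong[OF refl])
      fix y assume "y \<in> ?Y"
      then obtain c p e r where y: "y = ((c, p), (e, r))" and "apath c p b" "(e, r) \<in> cycles_at c"
        "set (?v (head G e) r) \<subseteq> insert c (?U c p)"
        by (auto simp: apaths_to_def)
      moreover from this have "insert c (?U c p) - set (?v (head G e) r) = ?U (head G e) (r @ p)" "tail G e = c"
        using split[of c p e r] by (auto simp: cycles_at_def)
      ultimately show "?z y = t (?f y)"
        by (simp add: t_def mult_ac)
    qed
  qed
  finally have S3: "sum s ?AP = S - sum t ?T2" .
  from S1 S2 S3 show ?thesis by (simp add: algebra_simps)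
qed

end

section \<open>Walks in the cover and in the projection\<close>

sublocale cylindrical_network \<subseteq> proj: fin_digraph "projection (m, 0) V E"
  by (rule finite_projection)

sublocale cylindrical_network \<subseteq> cover: wf_digraph "cover_graph V E"
  by unfold_locales (use edges in \<open>auto simp: cover_graph_def\<close>)

context cylindrical_network
begin

declare scaleR_Pair [simp del]

abbreviation g :: point where "g \<equiv> (m, 0)"
abbreviation G where "G \<equiv> projection (m, 0) V E"

section \<open>Coordinates on the cover: vertex class and integer position\<close>

definition cls :: "point \<Rightarrow> point set" where
  "cls x = translates g V `` {x}"

text \<open>An arbitrary element of each class serves as its origin, which identifies the cover
  vertices with pairs of a class and an integer; \<open>pos\<close> reads off the integer.\<close>

definition pt :: "point set \<Rightarrow> int \<Rightarrow> point" where
  "pt a k = (SOME x. x \<in> a) + of_int k *\<^sub>R g"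

definition pos :: "point \<Rightarrow> int" where
  "pos x = (THE k. x = pt (cls x) k)"

lemma cover_simps [simp]:
  "verts (cover_graph V E) = V" "arcs (cover_graph V E) = E"
  "tail (cover_graph V E) = fst" "head (cover_graph V E) = snd"
  by (simp_all add: cover_graph_def)

lemma shift_mem: "x \<in> V \<Longrightarrow> x + of_int k *\<^sub>R g \<in> V"
proof (rule shift_int_closed)
  show "x - g \<in> V" if "x \<in> V" for x
  proof -
    obtain w where "w \<in> V" "x = w + g"
      using shift_verts \<open>x \<in> V\<close> by blast
    then show ?thesis by simp
  qed
qed (use shift_verts in auto)

lemma shift_inj: "x + of_int k *\<^sub>R g = x + of_int l *\<^sub>R g \<Longrightarrow> k = l"
  using shift_pos by (auto simp: prod_eq_iff)

lemma cls_eq: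
  assumes "x \<in> V"
  shows "cls x = range (\<lambda>k::int. x + of_int k *\<^sub>R g)"
  using assms shift_mem[OF assms] by (auto simp: cls_def translates_def)

lemma cls_shift: "x \<in> V \<Longrightarrow> cls (x + of_int k *\<^sub>R g) = cls x"
  unfolding cls_def
  by (rule equiv_class_eq[OF equiv_translates, symmetric]) (auto simp: translates_def shift_mem)

lemma verts_proj: "verts G = cls ` V"
  by (auto simp: projection_def quotient_def cls_def)

lemma pt_add: "pt a (k + l) = pt a k + of_int l *\<^sub>R g"
  by (simp add: pt_def scaleR_add_left)

lemma pt_exists:
  assumes "x \<in> V"
  obtains k where "x = pt (cls x) k"
proof -
  have "x \<in> cls x" using cls_eq[OF assms] by (auto intro: range_eqI[of _ _ 0])
  then have "(SOME y. y \<in> cls x) \<in> cls x" by (rule someI)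
  then obtain k :: int where "(SOME y. y \<in> cls x) = x + of_int k *\<^sub>R g"
    using cls_eq[OF assms] by auto
  then have "x = pt (cls x) (- k)"
    by (simp add: pt_def)
  then show ?thesis by (rule that)
qed

lemma pt_inj: "pt a k = pt a l \<longleftrightarrow> k = l"
  using shift_inj unfolding pt_def by blast

lemma pt_pos [simp]:
  assumes "x \<in> V"
  shows "pt (cls x) (pos x) = x"
proof -
  obtain k where k: "x = pt (cls x) k" using pt_exists[OF assms] .
  then have "pos x = k"
    unfolding pos_def by (intro the_equality) (use pt_inj in metis)+
  with k show ?thesis by simp
qed

lemma
  assumes "a \<in> verts G"
  shows pt_mem [simp]: "pt a k \<in> V"
    and cls_pt [simp]: "cls (pt a k) = a"
    and pos_pt [simp]: "pos (pt a k) = k"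
proof -
  obtain x where x: "x \<in> V" "a = cls x" using assms by (auto simp: verts_proj)
  have *: "pt a k = x + of_int (k - pos x) *\<^sub>R g" for k
    using pt_add[of a "pos x" "k - pos x"] x by simp
  show mem: "pt a k \<in> V" for k
    unfolding * using x(1) by (rule shift_mem)
  show cls: "cls (pt a k) = a" for k
    unfolding * using cls_shift[OF x(1), of "k - pos x"] x(2) by simp
  show "pos (pt a k) = k"
    using pt_pos[OF mem[of k]] pt_inj[of a] by (simp add: cls)
qed

lemma pt_shift: "x \<in> V \<Longrightarrow> pt (cls x) (pos x + k) = x + of_int k *\<^sub>R g"
  by (simp add: pt_add)

lemma pos_shift:
  assumes "x \<in> V"
  shows "pos (x + of_int k *\<^sub>R g) = pos x + k"
proof -
  have "cls x \<in> verts G" using assms by (simp add: verts_proj)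
  then show ?thesis using pos_pt[of "cls x" "pos x + k"] pt_shift[OF assms, of k] by simp
qed

section \<open>Edge classes, their weights and shifts\<close>

lemma edge_shift_nat:
  "(x, y) \<in> E \<Longrightarrow> (x + real n *\<^sub>R g, y + real n *\<^sub>R g) \<in> E \<and>
     wt (x + real n *\<^sub>R g, y + real n *\<^sub>R g) = wt (x, y)"
proof (induction n)
  case 0
  then show ?case by simp
next
  case (Suc n)
  have *: "z + real (Suc n) *\<^sub>R g = (z + real n *\<^sub>R g) + g" for z :: point
    by (simp add: algebra_simps prod_eq_iff)
  show ?case unfolding * using shift_edges shift_wt Suc by metis
qed

lemma translate_pair: "e + r *\<^sub>R (g, g) = (fst e + r *\<^sub>R g, snd e + r *\<^sub>R g)"
  by (simp add: prod_eq_iff)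

lemma edge_class_mem_iff:
  assumes "e \<in> E"
  shows "e' \<in> edge_class g E e \<longleftrightarrow>
    e' \<in> E \<and> (\<exists>k::int. e' = (fst e + of_int k *\<^sub>R g, snd e + of_int k *\<^sub>R g))"
  using assms by (simp add: edge_class_def translates_def translate_pair)

lemma edge_class_eqI:
  assumes "(x, y) \<in> E" "(x + of_int k *\<^sub>R g, y + of_int k *\<^sub>R g) \<in> E"
  shows "edge_class g E (x + of_int k *\<^sub>R g, y + of_int k *\<^sub>R g) = edge_class g E (x, y)"
  unfolding edge_class_def
  by (rule equiv_class_eq[OF equiv_translates, symmetric]) (use assms in \<open>auto simp: translates_def translate_pair\<close>)

lemma edge_class_self: "e \<in> E \<Longrightarrow> e \<in> edge_class g E e"
  by (auto simp: edge_class_mem_iff intro!: exI[of _ 0])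

lemma arcs_proj: "arcs G = edge_class g E ` E"
  by (auto simp: projection_def quotient_def edge_class_def)

lemma
  assumes "(x, y) \<in> E"
  shows tail_edge_class: "tail G (edge_class g E (x, y)) = cls x"
    and head_edge_class: "head G (edge_class g E (x, y)) = cls y"
proof -
  have V: "x \<in> V" "y \<in> V" using assms edges by auto
  have *: "translates g V `` A = (\<Union>z\<in>A. cls z)" for A
    by (auto simp: cls_def)
  have "cls (fst e') = cls x \<and> cls (snd e') = cls y" if "e' \<in> edge_class g E (x, y)" for e'
    using that cls_shift[OF V(1)] cls_shift[OF V(2)] unfolding edge_class_mem_iff[OF assms] by auto
  with edge_class_self[OF assms]
  show "tail G (edge_class g E (x, y)) = cls x" "head G (edge_class g E (x, y)) = cls y"
    by (auto simp: projection_def *)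
qed

text \<open>Invariance is available only for translations to the right, so of two edges in a class
  the left one is moved onto the other.\<close>

lemma wt_edge_class:
  assumes "e \<in> E"
  shows "edge_weight wt (edge_class g E e) = wt e"
proof -
  have "wt e' = wt e" if e': "e' \<in> edge_class g E e" for e'
  proof -
    obtain k :: int where k: "e' \<in> E" "e' = (fst e + of_int k *\<^sub>R g, snd e + of_int k *\<^sub>R g)"
      using e' unfolding edge_class_mem_iff[OF assms] by blast
    show ?thesis
    proof (cases "k \<ge> 0")
      case True
      then show ?thesis
        using edge_shift_nat[of "fst e" "snd e" "nat k"] assms k(2) by simp
    next
      case False
      have "e = (fst e' + real (nat (- k)) *\<^sub>R g, snd e' + real (nat (- k)) *\<^sub>R g)"
        using False by (simp add: k(2) prod_eq_iff algebra_simps)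
      then show ?thesis
        using edge_shift_nat[of "fst e'" "snd e'" "nat (- k)"] k(1) by simp
    qed
  qed
  then have "wt ` edge_class g E e = {wt e}"
    using edge_class_self[OF assms] by blast
  then show ?thesis by (simp add: edge_weight_def)
qed

text \<open>The change of position along any representative. Moving the origin of a class changes
  the shifts of single arcs, but not the total around a closed walk.\<close>

definition shift_of :: "(point \<times> point) set \<Rightarrow> int" where
  "shift_of c = (let e = SOME e. e \<in> c in pos (snd e) - pos (fst e))"

lemma shift_edge_class:
  assumes "(x, y) \<in> E"
  shows "shift_of (edge_class g E (x, y)) = pos y - pos x"
proof -
  define e where "e = (SOME e. e \<in> edge_class g E (x, y))"
  have "e \<in> edge_class g E (x, y)"
    unfolding e_def using edge_class_self[OF assms] by (rule someI)
  then obtain k :: int where "e = (x + of_int k *\<^sub>R g, y + of_int k *\<^sub>R g)"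
    using assms by (auto simp: edge_class_mem_iff)
  moreover have "x \<in> V" "y \<in> V" using assms edges by auto
  ultimately show ?thesis
    by (simp add: shift_of_def e_def[symmetric] pos_shift)
qed

text \<open>Edge classes need not be invariant under \<open>-g\<close>, but they contain all translates far to the right.\<close>

lemma edges_far_right:
  obtains N where "\<And>c k. c \<in> arcs G \<Longrightarrow> k \<ge> N \<Longrightarrow>
    (pt (tail G c) k, pt (head G c) (k + shift_of c)) \<in> E \<and>
    edge_class g E (pt (tail G c) k, pt (head G c) (k + shift_of c)) = c"
proof -
  have "\<forall>\<^sub>F k in at_top. (pt (tail G c) k, pt (head G c) (k + shift_of c)) \<in> E \<and>
      edge_class g E (pt (tail G c) k, pt (head G c) (k + shift_of c)) = c"
    if c: "c \<in> arcs G" for c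
  proof -
    obtain x y where xy: "(x, y) \<in> E" "c = edge_class g E (x, y)"
      using c by (auto simp: arcs_proj)
    then have V: "x \<in> V" "y \<in> V" using edges by auto
    have "(pt (tail G c) k, pt (head G c) (k + shift_of c)) \<in> E \<and>
      edge_class g E (pt (tail G c) k, pt (head G c) (k + shift_of c)) = c"
      if k: "k \<ge> pos x" for k
    proof -
      have "pt (tail G c) k = x + of_int (k - pos x) *\<^sub>R g"
        using pt_shift[OF V(1), of "k - pos x"] by (simp add: xy(2) tail_edge_class[OF xy(1)])
      moreover have "pt (head G c) (k + shift_of c) = y + of_int (k - pos x) *\<^sub>R g"
        using pt_shift[OF V(2), of "k - pos x"]
        by (simp add: xy(2) head_edge_class[OF xy(1)] shift_edge_class[OF xy(1)] algebra_simps)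
      moreover have "(x + of_int (k - pos x) *\<^sub>R g, y + of_int (k - pos x) *\<^sub>R g) \<in> E"
        using edge_shift_nat[OF xy(1), of "nat (k - pos x)"] k by simp
      ultimately show ?thesis
        using edge_class_eqI[OF xy(1), of "k - pos x"] xy(2) by simp
    qed
    then show ?thesis unfolding eventually_at_top_linorder by blast
  qed
  then have "\<forall>\<^sub>F k in at_top. \<forall>c\<in>arcs G. (pt (tail G c) k, pt (head G c) (k + shift_of c)) \<in> E \<and>
      edge_class g E (pt (tail G c) k, pt (head G c) (k + shift_of c)) = c"
    by (intro eventually_ball_finite proj.finite_arcs) blast
  then show ?thesis
    using that unfolding eventually_at_top_linorder by blast
qed

section \<open>Projecting and lifting walks\<close>

lemma walk_project:
  "cover.awalk x p y \<Longrightarrow> proj.awalk (cls x) (map (edge_class g E) p) (cls y) \<and>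
     sum_list (map shift_of (map (edge_class g E) p)) = pos y - pos x"
proof (induction p arbitrary: x)
  case Nil
  then show ?case by (auto simp: cover.awalk_Nil_iff proj.awalk_Nil_iff verts_proj)
next
  case (Cons e p)
  obtain z where e: "e = (x, z)" "(x, z) \<in> E" "cover.awalk z p y"
    using Cons.prems by (cases e) (auto simp: cover.awalk_Cons_iff)
  have "edge_class g E e \<in> arcs G" using e by (auto simp: arcs_proj)
  then show ?case
    using Cons.IH[OF e(3)] tail_edge_class[OF e(2)] head_edge_class[OF e(2)] shift_edge_class[OF e(2)]
    by (simp add: proj.awalk_Cons_iff e(1))
qed

lemma walk_lift:
  assumes "proj.awalk a p b"
  shows "\<exists>N. \<forall>k\<ge>N. \<exists>q. cover.awalk (pt a k) q (pt b (k + sum_list (map shift_of p))) \<and>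
    map (edge_class g E) q = p"
  using assms
proof (induction p arbitrary: a)
  case Nil
  then show ?case by (auto simp: cover.awalk_Nil_iff proj.awalk_Nil_iff)
next
  case (Cons c p)
  then have c: "c \<in> arcs G" "a = tail G c" "proj.awalk (head G c) p b"
    by (auto simp: proj.awalk_Cons_iff)
  obtain N where N: "\<And>k. k \<ge> N \<Longrightarrow> \<exists>q. cover.awalk (pt (head G c) k) q
      (pt b (k + sum_list (map shift_of p))) \<and> map (edge_class g E) q = p"
    using Cons.IH[OF c(3)] by blast
  obtain N' where N': "\<And>c k. c \<in> arcs G \<Longrightarrow> k \<ge> N' \<Longrightarrow>
    (pt (tail G c) k, pt (head G c) (k + shift_of c)) \<in> E \<and>
    edge_class g E (pt (tail G c) k, pt (head G c) (k + shift_of c)) = c"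
    using edges_far_right by blast
  show ?case
  \<comment> \<open>The first arc has to lift at position \<open>k\<close>, the remaining walk at
    \<open>k + shift_of c\<close>.\<close>
  proof (intro exI[of _ "max N' (N - shift_of c)"] allI impI)
    fix k assume "k \<ge> max N' (N - shift_of c)"
    then have k: "k \<ge> N'" "k + shift_of c \<ge> N" by auto
    obtain q where q: "cover.awalk (pt (head G c) (k + shift_of c)) q
      (pt b (k + shift_of c + sum_list (map shift_of p)))" "map (edge_class g E) q = p"
      using N[OF k(2)] by blast
    let ?e = "(pt (tail G c) k, pt (head G c) (k + shift_of c))"
    show "\<exists>q. cover.awalk (pt a k) q (pt b (k + sum_list (map shift_of (c # p)))) \<and>
      map (edge_class g E) q = c # p"
      using q N'[OF c(1) k(1)] c(2)
      by (intro exI[of _ "?e # q"]) (simp add: cover.awalk_Cons_iff add.assoc)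
  qed
qed

text \<open>A lift leads from a point to its translate by the total shift, so acyclicity of the
  cover applies.\<close>

lemma closed_walk_shift_pos:
  assumes "proj.awalk a p a" "p \<noteq> []"
  shows "sum_list (map shift_of p) > 0"
proof -
  obtain k q where "cover.awalk (pt a k) q (pt a (k + sum_list (map shift_of p)))"
    "map (edge_class g E) q = p"
    using walk_lift[OF assms(1)] by blast
  then show ?thesis
    using acyclic[of "pt a k" q "sum_list (map shift_of p)"] assms(2) by (auto simp: pt_add)
qed

section \<open>Bounds on positions and finiteness of path sums\<close>

definition shift_bound :: int where
  "shift_bound = (\<Sum>c\<in>arcs G. \<bar>shift_of c\<bar>)"

text \<open>Removing a closed subwalk lowers the shift, since that subwalk has positive shift. Once
  all vertices are distinct, every arc occurs at most once and the absolute shifts add up to at most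
  \<open>shift_bound\<close>.\<close>

lemma walk_shift_ge: "proj.awalk a p b \<Longrightarrow> sum_list (map shift_of p) \<ge> - shift_bound"
proof (induction "length p" arbitrary: p rule: less_induct)
  case less
  show ?case
  proof (cases "distinct (proj.awalk_verts a p)")
    case True
    then have "distinct p"
      using less.prems proj.distinct_verts_imp_distinct by blast
    then have "sum_list (map shift_of p) = sum shift_of (set p)"
      by (rule sum_list_distinct_conv_sum_set)
    moreover have "\<dots> \<ge> - (\<Sum>c\<in>set p. \<bar>shift_of c\<bar>)"
      unfolding sum_negf[symmetric] by (rule sum_mono) auto
    moreover have "(\<Sum>c\<in>set p. \<bar>shift_of c\<bar>) \<le> shift_bound"
      unfolding shift_bound_def using less.prems by (intro sum_mono2) auto
    ultimately show ?thesis by linarith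
  next
    case False
    then obtain q r s w where qrs: "p = q @ r @ s" "0 < length r" "proj.awalk a q w" "proj.awalk w r w"
        "proj.awalk w s b"
      using proj.awalk_not_distinct_decomp[OF less.prems] by blast
    then have "sum_list (map shift_of (q @ s)) \<ge> - shift_bound"
      by (intro less.hyps) (auto intro: proj.awalk_appendI simp del: proj.awalk_append_iff)
    moreover have "sum_list (map shift_of r) > 0"
      using closed_walk_shift_pos qrs by blast
    ultimately show ?thesis by (simp add: qrs(1))
  qed
qed

lemma cover_walk_pos_ge: "cover.awalk x p y \<Longrightarrow> pos y \<ge> pos x - shift_bound"
  using walk_project[of x p y] walk_shift_ge[of "cls x" "map (edge_class g E) p" "cls y"] by linarith

text \<open>A repeated vertex would give a nonempty closed walk in the cover, that is, one with
  \<open>l = 0\<close>.\<close>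

lemma cover_walk_distinct:
  assumes "cover.awalk x p y"
  shows "distinct p"
proof -
  have "distinct (cover.awalk_verts x p)"
  proof (rule ccontr)
    assume "\<not> ?thesis"
    then obtain r w where "0 < length r" "cover.awalk w r w"
      using cover.awalk_not_distinct_decomp[OF assms] by blast
    then show False
      using acyclic[of w r 0] by simp
  qed
  then show ?thesis
    using assms cover.distinct_verts_imp_distinct by blast
qed

text \<open>Each vertex of the walk is reached from \<open>x\<close> and reaches \<open>y\<close>,
  which confines its position to a finite window; and no edge is repeated. Hence
  \<open>path_sum\<close> is a true sum and not the default 0 of a sum over an infinite set.\<close>

lemma finite_cover_walks: "finite {p. cover.awalk x p y}"
proof -
  define W where "W = case_prod pt ` (verts G \<times> {pos x - shift_bound .. pos y + shift_bound})"
  have W: "z \<in> W" if "cover.awalk x q z" "cover.awalk z r y" for q r z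
  proof -
    have "z \<in> V" using that by auto
    then have "z = case_prod pt (cls z, pos z)" "cls z \<in> verts G"
      by (auto simp: verts_proj)
    moreover have "pos z \<in> {pos x - shift_bound .. pos y + shift_bound}"
      using cover_walk_pos_ge[OF that(1)] cover_walk_pos_ge[OF that(2)] by simp
    ultimately show ?thesis unfolding W_def by blast
  qed
  have "set p \<subseteq> W \<times> W" if p: "cover.awalk x p y" for p
  proof
    fix e assume "e \<in> set p"
    then obtain q r where p_eq: "p = q @ e # r" by (meson split_list)
    have "cover.awalk x q (fst e)" "cover.awalk (fst e) (e # r) y" "cover.awalk (snd e) r y"
      "cover.awalk (fst e) [e] (snd e)"
      using p unfolding p_eq by (auto simp: cover.awalk_simps)
    moreover from this have "cover.awalk x (q @ [e]) (snd e)"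
      by (blast intro: cover.awalk_appendI)
    ultimately have "fst e \<in> W" "snd e \<in> W" using W by blast+
    then show "e \<in> W \<times> W" by (simp add: mem_Times_iff)
  qed
  then have "{p. cover.awalk x p y} \<subseteq> {p. set p \<subseteq> W \<times> W \<and> distinct p}"
    using cover_walk_distinct by blast
  moreover have "finite (W \<times> W)" by (simp add: W_def)
  ultimately show ?thesis
    using finite_subset finite_subset_distinct by blast
qed

section \<open>Splitting off the last edge of a path\<close>

lemma cover_walk_snoc_iff:
  "cover.awalk x (q @ [e]) y \<longleftrightarrow> e \<in> E \<and> snd e = y \<and> cover.awalk x q (fst e)"
proof
  assume "cover.awalk x (q @ [e]) y"
  then show "e \<in> E \<and> snd e = y \<and> cover.awalk x q (fst e)"
    by (auto simp: cover.awalk_simps)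
next
  assume *: "e \<in> E \<and> snd e = y \<and> cover.awalk x q (fst e)"
  then have "cover.awalk (fst e) [e] y"
    using cover.arc_implies_awalk[of e] by simp
  with * show "cover.awalk x (q @ [e]) y"
    by (blast intro: cover.awalk_appendI)
qed

lemma path_sum_rec:
  assumes "u \<in> V" "x \<in> V" "x \<noteq> u"
  shows "path_sum V E wt u x = (\<Sum>e | e \<in> E \<and> snd e = x. wt e * path_sum V E wt u (fst e))"
proof -
  let ?I = "{e. e \<in> E \<and> snd e = x}"
  let ?S = "SIGMA e:?I. {q. cover.awalk u q (fst e)}"
  have fin: "finite ?I" using finite_in[OF assms(2)] .
  have "bij_betw (\<lambda>(e, q). q @ [e]) ?S {p. cover.awalk u p x}"
    unfolding bij_betw_def
  proof
    show "inj_on (\<lambda>(e, q). q @ [e]) ?S" by (auto simp: inj_on_def)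
    show "(\<lambda>(e, q). q @ [e]) ` ?S = {p. cover.awalk u p x}"
    proof (intro equalityI subsetI)
      fix p assume "p \<in> {p. cover.awalk u p x}"
      moreover from this have "p \<noteq> []" using assms(3) by (auto simp: cover.awalk_Nil_iff)
      then obtain q e where "p = q @ [e]" by (metis append_butlast_last_id)
      ultimately have "(e, q) \<in> ?S" "p = (\<lambda>(e, q). q @ [e]) (e, q)"
        by (auto simp: cover_walk_snoc_iff simp del: cover.awalk_append_iff)
      then show "p \<in> (\<lambda>(e, q). q @ [e]) ` ?S" by blast
    qed (auto simp: cover_walk_snoc_iff simp del: cover.awalk_append_iff)
  qed
  from sum.reindex_bij_betw[OF this, of "\<lambda>p. prod_list (map wt p)"]
  have "path_sum V E wt u x = (\<Sum>(e, q)\<in>?S. wt e * prod_list (map wt q))"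
    by (simp add: path_sum_def case_prod_unfold mult.commute)
  also have "\<dots> = (\<Sum>e\<in>?I. \<Sum>q | cover.awalk u q (fst e). wt e * prod_list (map wt q))"
    using fin finite_cover_walks by (intro sum.Sigma[symmetric]) auto
  finally show ?thesis
    by (simp add: path_sum_def sum_distrib_left)
qed

text \<open>This bound on the support is what makes the path sums into one class a Laurent
  series.\<close>

lemma path_sum_eq_0:
  assumes "a \<in> verts G" "k < pos u - shift_bound"
  shows "path_sum V E wt u (pt a k) = 0"
proof -
  have "{p. cover.awalk u p (pt a k)} = {}"
    using cover_walk_pos_ge[of u _ "pt a k"] assms by force
  then show ?thesis by (simp add: path_sum_def)
qed

lemma path_sum_rec_proj:
  assumes "u \<in> V" "b \<in> verts G"
  shows "\<exists>N. \<forall>n\<ge>N. path_sum V E wt u (pt b n) =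
    (\<Sum>c | c \<in> arcs G \<and> head G c = b. edge_weight wt c * path_sum V E wt u (pt (tail G c) (n - shift_of c)))"
proof -
  obtain N where N: "\<And>c k. c \<in> arcs G \<Longrightarrow> k \<ge> N \<Longrightarrow>
    (pt (tail G c) k, pt (head G c) (k + shift_of c)) \<in> E \<and>
    edge_class g E (pt (tail G c) k, pt (head G c) (k + shift_of c)) = c"
    using edges_far_right by blast
  \<comment> \<open>Beyond \<open>pos u + 1\<close> the endpoint differs from \<open>u\<close>, so
    every path has a last edge. Beyond \<open>N + shift_bound\<close> all tails
    \<open>n - shift_of c\<close> are at least \<open>N\<close>, so every arc into \<open>b\<close>
    lifts to an edge ending at \<open>pt b n\<close>.\<close>
  have "path_sum V E wt u (pt b n) =
    (\<Sum>c | c \<in> arcs G \<and> head G c = b. edge_weight wt c * path_sum V E wt u (pt (tail G c) (n - shift_of c)))"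
    if n: "n \<ge> max (pos u + 1) (N + shift_bound)" for n
  proof -
    have sb: "shift_of c \<le> shift_bound" if "c \<in> arcs G" for c
      using member_le_sum[of c "arcs G" "\<lambda>c. \<bar>shift_of c\<bar>"] that by (simp add: shift_bound_def)
    have lifted: "(pt (tail G c) (n - shift_of c), pt b n) \<in> E \<and>
        edge_class g E (pt (tail G c) (n - shift_of c), pt b n) = c"
      if "c \<in> arcs G" "head G c = b" for c
      using N[of c "n - shift_of c"] sb[of c] that n by simp
    have "pt b n \<noteq> u" using n assms(2) pos_pt[of b n] by auto
    then have "path_sum V E wt u (pt b n) =
        (\<Sum>e | e \<in> E \<and> snd e = pt b n. wt e * path_sum V E wt u (fst e))"
      using path_sum_rec assms by simp
    also have "\<dots> = (\<Sum>c | c \<in> arcs G \<and> head G c = b.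
        edge_weight wt c * path_sum V E wt u (pt (tail G c) (n - shift_of c)))"
    proof (rule sum.reindex_bij_witness[of _ "\<lambda>c. (pt (tail G c) (n - shift_of c), pt b n)" "edge_class g E"])
      fix e assume e: "e \<in> {e. e \<in> E \<and> snd e = pt b n}"
      then obtain x where x: "e = (x, pt b n)" "(x, pt b n) \<in> E" by (cases e) auto
      then have "x \<in> V" using edges by auto
      have c: "edge_class g E e \<in> arcs G" "head G (edge_class g E e) = b"
        using x assms(2) head_edge_class[OF x(2)] by (auto simp: arcs_proj)
      have "pt (tail G (edge_class g E e)) (n - shift_of (edge_class g E e)) = x"
        using \<open>x \<in> V\<close> assms(2) by (simp add: x(1) tail_edge_class[OF x(2)] shift_edge_class[OF x(2)])
      with c e show "(pt (tail G (edge_class g E e)) (n - shift_of (edge_class g E e)), pt b n) = e"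
        "edge_class g E e \<in> {c \<in> arcs G. head G c = b}"
        "edge_weight wt (edge_class g E e) *
          path_sum V E wt u (pt (tail G (edge_class g E e)) (n - shift_of (edge_class g E e))) =
         wt e * path_sum V E wt u (fst e)"
        by (auto simp: x(1) wt_edge_class)
    next
      fix c assume c: "c \<in> {c \<in> arcs G. head G c = b}"
      then show "edge_class g E (pt (tail G c) (n - shift_of c), pt b n) = c"
        "(pt (tail G c) (n - shift_of c), pt b n) \<in> {e. e \<in> E \<and> snd e = pt b n}"
        using lifted by auto
    qed
    finally show ?thesis .
  qed
  then show ?thesis by blast
qed

end

section \<open>Laurent series with finitely many nonzero terms\<close>

unbundle Formal_Laurent_Series.fps_syntax

text \<open>A Laurent series vanishes far to the left anyway, so these are the Laurent
  polynomials.\<close>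

definition fls_bounded :: "'a::zero fls \<Rightarrow> bool" where
  "fls_bounded f \<longleftrightarrow> (\<forall>\<^sub>F n in at_top. f $$ n = 0)"

definition fls_monom :: "'a::semiring_1 \<Rightarrow> int \<Rightarrow> 'a fls" where
  "fls_monom c k = fls_const c * fls_X_intpow k"

lemma fls_monom_times_nth:
  fixes f :: "'a::comm_semiring_1 fls"
  shows "(fls_monom c k * f) $$ n = c * f $$ (n - k)"
  unfolding fls_monom_def mult.assoc[of _ _ f] fls_X_intpow_times_conv_shift(1) by simp

lemma fls_monom_mult:
  fixes c d :: "'a::comm_semiring_1"
  shows "fls_monom c k * fls_monom d l = fls_monom (c * d) (k + l)"
proof -
  have "fls_monom c k * fls_monom d l = (fls_const c * fls_const d) * (fls_X_intpow k * fls_X_intpow l)"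
    unfolding fls_monom_def by (simp only: mult_ac)
  then show ?thesis
    unfolding fls_monom_def fls_X_intpow_times_fls_X_intpow fls_const_mult_const .
qed

lemma fls_monom_uminus: "- fls_monom (c::'a::comm_ring_1) k = fls_monom (- c) k"
  by (simp add: fls_monom_def)

lemma fls_monom_prod:
  fixes c :: "'b \<Rightarrow> 'a::comm_semiring_1"
  shows "finite A \<Longrightarrow> (\<Prod>x\<in>A. fls_monom (c x) (k x)) = fls_monom (\<Prod>x\<in>A. c x) (\<Sum>x\<in>A. k x)"
  by (induction A rule: finite_induct) (simp_all add: fls_monom_mult, simp add: fls_monom_def)

lemma fls_bounded_0 [simp]: "fls_bounded 0"
  by (simp add: fls_bounded_def)

lemma fls_bounded_monom [simp]: "fls_bounded (fls_monom (c::'a::comm_semiring_1) k)"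
proof -
  have "fls_monom c k $$ n = 0" if "n \<ge> k + 1" for n
    using fls_monom_times_nth[of c k 1 n] that by simp
  then show ?thesis
    unfolding fls_bounded_def eventually_at_top_linorder by blast
qed

lemma fls_bounded_1 [simp]: "fls_bounded (1::'a::comm_semiring_1 fls)"
  using fls_bounded_monom[of "1::'a" 0] by (simp add: fls_monom_def)

lemma fls_bounded_add: "fls_bounded f \<Longrightarrow> fls_bounded g \<Longrightarrow> fls_bounded (f + g)"
  for f g :: "'a::monoid_add fls"
  unfolding fls_bounded_def by (drule (1) eventually_conj) (auto elim: eventually_mono)

lemma fls_bounded_uminus: "fls_bounded f \<Longrightarrow> fls_bounded (- f)"
  for f :: "'a::group_add fls"
  by (simp add: fls_bounded_def)

lemma fls_bounded_mult:
  fixes f h :: "'a::comm_semiring_1 fls"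
  assumes "fls_bounded f" "fls_bounded h"
  shows "fls_bounded (f * h)"
proof -
  obtain M N where M: "\<And>n. n \<ge> M \<Longrightarrow> f $$ n = 0" and N: "\<And>n. n \<ge> N \<Longrightarrow> h $$ n = 0"
    using assms unfolding fls_bounded_def eventually_at_top_linorder by blast
  have "(f * h) $$ n = 0" if "n \<ge> M + N" for n
  proof -
    have "f $$ i * h $$ (n - i) = 0" for i
      using M[of i] N[of "n - i"] that by (cases "i \<ge> M") auto
    then show ?thesis by (simp add: fls_times_nth(2))
  qed
  then show ?thesis
    unfolding fls_bounded_def eventually_at_top_linorder by blast
qed

lemma fls_bounded_sum:
  fixes f :: "'b \<Rightarrow> 'a::comm_monoid_add fls"
  shows "(\<And>x. x \<in> A \<Longrightarrow> fls_bounded (f x)) \<Longrightarrow> fls_bounded (sum f A)"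
  by (induction A rule: infinite_finite_induct) (auto intro: fls_bounded_add)

lemma fls_bounded_prod:
  fixes f :: "'b \<Rightarrow> 'a::comm_semiring_1 fls"
  shows "(\<And>x. x \<in> A \<Longrightarrow> fls_bounded (f x)) \<Longrightarrow> fls_bounded (prod f A)"
  by (induction A rule: infinite_finite_induct) (auto intro: fls_bounded_mult)

lemma fls_bounded_prod_list:
  fixes w :: "'b \<Rightarrow> 'a::comm_semiring_1 fls"
  shows "(\<And>x. fls_bounded (w x)) \<Longrightarrow> fls_bounded (prod_list (map w xs))"
  by (induction xs) (auto intro: fls_bounded_mult)

lemma smult_sum_right: "smult c (\<Sum>x\<in>A. f x) = (\<Sum>x\<in>A. smult c (f x))"
  by (induction A rule: infinite_finite_induct) (simp_all add: smult_add_right)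

text \<open>The left side is the linear functional sending t^i to \<open>f i\<close>, applied to
  \<open>Q\<close>, and may be evaluated monomial by monomial even if exponents coincide. The degree
  condition keeps every exponent in range should top terms cancel.\<close>

lemma sum_coeff_sum_monom:
  fixes c :: "'b \<Rightarrow> 'a::comm_semiring_1"
  assumes "Q = (\<Sum>x\<in>A. monom (c x) (k x))" "\<And>x. x \<in> A \<Longrightarrow> k x \<le> degree Q"
  shows "(\<Sum>i\<le>degree Q. coeff Q i * f i) = (\<Sum>x\<in>A. c x * f (k x))"
proof -
  have "(\<Sum>i\<le>degree Q. coeff Q i * f i) = (\<Sum>i\<le>degree Q. \<Sum>x\<in>A. (if k x = i then c x * f i else 0))"
    unfolding assms(1) by (simp add: coeff_sum sum_distrib_right if_distrib[of "\<lambda>y. y * _"] cong: if_cong)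
  also have "\<dots> = (\<Sum>x\<in>A. \<Sum>i\<le>degree Q. (if k x = i then c x * f i else 0))"
    by (rule sum.swap)
  also have "\<dots> = (\<Sum>x\<in>A. c x * f (k x))"
    using assms(2) by (intro sum.cong) auto
  finally show ?thesis .
qed

section \<open>Path series and the recurrence\<close>

context cylindrical_network
begin


definition path_series :: "point \<Rightarrow> point set \<Rightarrow> 'k fls" where
  "path_series u a = Abs_fls (\<lambda>k. path_sum V E wt u (pt a k))"

definition arc_series :: "(point \<times> point) set \<Rightarrow> 'k fls" where
  "arc_series c = fls_monom (edge_weight wt c) (shift_of c)"

lemma path_series_nth: "a \<in> verts G \<Longrightarrow> path_series u a $$ k = path_sum V E wt u (pt a k)"
  unfolding path_series_def
  by (rule nth_Abs_fls_lower_bound[of "pos u - shift_bound"]) (simp add: path_sum_eq_0)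

lemma fls_bounded_packing_sum: "fls_bounded (proj.packing_sum arc_series W)"
  unfolding proj.packing_sum_def arc_series_def
  by (intro fls_bounded_sum fls_bounded_prod fls_bounded_uminus) simp

lemma fls_bounded_packing_path_series:
  assumes "u \<in> V" "b \<in> verts G"
  shows "fls_bounded (proj.packing_sum arc_series (verts G) * path_series u b)"
proof -
  \<comment> \<open>The defect of the last-edge recursion; \<open>path_sum_rec_proj\<close> makes it
    vanish at high positions.\<close>
  define q where "q b = path_series u b -
    (\<Sum>c | c \<in> arcs G \<and> head G c = b. arc_series c * path_series u (tail G c))" for b
  have "fls_bounded (q a)" if "a \<in> verts G" for a
  proof -
    obtain N where N: "\<And>n. n \<ge> N \<Longrightarrow> path_sum V E wt u (pt a n) =
      (\<Sum>c | c \<in> arcs G \<and> head G c = a. edge_weight wt c * path_sum V E wt u (pt (tail G c) (n - shift_of c)))"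
      using path_sum_rec_proj[OF assms(1) \<open>a \<in> verts G\<close>] by blast
    have "q a $$ n = 0" if "n \<ge> N" for n
      using N[OF that] \<open>a \<in> verts G\<close>
      by (simp add: q_def fls_nth_sum arc_series_def fls_monom_times_nth path_series_nth)
    then show ?thesis
      unfolding fls_bounded_def eventually_at_top_linorder by blast
  qed
  moreover have "a \<in> verts G" if "(a, p) \<in> proj.apaths_to b" for a p
    using that by (auto simp: proj.apaths_to_def proj.apath_def)
  moreover have "fls_bounded (arc_series c)" for c
    by (simp add: arc_series_def)
  ultimately have "fls_bounded (\<Sum>(a, p)\<in>proj.apaths_to b. prod_list (map arc_series p) *
      proj.packing_sum arc_series (verts G - set (proj.awalk_verts a p)) * q a)"
    by (intro fls_bounded_sum) (auto intro!: fls_bounded_mult fls_bounded_prod_list fls_bounded_packing_sum)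
  moreover have "path_series u b = q b +
      (\<Sum>c | c \<in> arcs G \<and> head G c = b. arc_series c * path_series u (tail G c))" for b
    by (simp add: q_def)
  then have "proj.packing_sum arc_series (verts G) * path_series u b =
      (\<Sum>(a, p)\<in>proj.apaths_to b. prod_list (map arc_series p) *
        proj.packing_sum arc_series (verts G - set (proj.awalk_verts a p)) * q a)"
    by (rule proj.packing_sum_mult_solution) (rule assms(2))
  ultimately show ?thesis by simp
qed

section \<open>Winding numbers and the polynomial Q_N\<close>

lemma simple_cycles_eq: "simple_cycles g V E = proj.cycle_sets"
  by (simp add: simple_cycles_def proj.cycle_sets_def)

lemma r_cycles_eq: "r_cycles g V E r = {Cs \<in> proj.packings (verts G). card Cs = r}"
proof -
  have "cycle_verts g V E C \<subseteq> verts G" if "C \<in> proj.cycle_sets" for C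
    using proj.cycle_sets_arcs[OF that] by (auto simp: cycle_verts_def)
  moreover have "finite Cs" if "Cs \<subseteq> proj.cycle_sets" for Cs
    using that proj.finite_cycle_sets finite_subset by blast
  ultimately show ?thesis
    unfolding r_cycles_def proj.packings_def simple_cycles_eq cycle_verts_def by blast
qed

text \<open>A lift traverses each arc of \<open>C\<close> once, so its ends differ by the total
  shift. Some lift exists far to the right, which makes the described integer unique.\<close>

lemma cycle_wind_eq:
  assumes "C \<in> proj.cycle_sets"
  shows "cycle_wind g V E C = (\<Sum>c\<in>C. shift_of c)"
proof -
  have lift: "w' = w + of_int (\<Sum>c\<in>C. shift_of c) *\<^sub>R g" if "is_lift g V E C w p w'" for w p w'
  proof -
    let ?es = "map (edge_class g E) p"
    have *: "cover.awalk w p w'" "proj.cycle ?es" "set ?es = C"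
      using that by (auto simp: is_lift_def)
    have pr: "proj.awalk (cls w) ?es (cls w')" "sum_list (map shift_of ?es) = pos w' - pos w"
      using walk_project[OF *(1)] by auto
    obtain a where "proj.awalk a ?es a" "distinct ?es" "?es \<noteq> []"
      using *(2) unfolding proj.cycle_conv by blast
    with pr(1) have "cls w = cls w'"
      using proj.awalk_ends by blast
    moreover have "(\<Sum>c\<in>C. shift_of c) = pos w' - pos w"
      using pr(2) sum_list_distinct_conv_sum_set[OF \<open>distinct ?es\<close>, of shift_of] *(3) by simp
    moreover have "w \<in> V" "w' \<in> V" using *(1) by auto
    ultimately show ?thesis
      using pt_shift[of w "pos w' - pos w"] pt_pos[of w'] by simp
  qed
  obtain es a where es: "C = set es" "proj.cycle es" "proj.awalk a es a"
    using assms by (auto simp: proj.cycle_sets_def proj.cycle_def)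
  then obtain k q where "cover.awalk (pt a k) q (pt a (k + sum_list (map shift_of es)))"
    "map (edge_class g E) q = es"
    using walk_lift[OF es(3)] by blast
  then have ex: "is_lift g V E C (pt a k) q (pt a (k + sum_list (map shift_of es)))"
    using es by (simp add: is_lift_def)
  show ?thesis
    unfolding cycle_wind_def
  proof (rule the_equality)
    fix l assume "\<forall>w p w'. is_lift g V E C w p w' \<longrightarrow> w' = w + of_int l *\<^sub>R g"
    then have "pt a k + of_int l *\<^sub>R g = pt a k + of_int (\<Sum>c\<in>C. shift_of c) *\<^sub>R g"
      using ex lift[OF ex] by metis
    then show "l = (\<Sum>c\<in>C. shift_of c)" by (rule shift_inj)
  qed (use lift in blast)
qed

lemma cycle_wind_pos:
  assumes "C \<in> proj.cycle_sets"
  shows "cycle_wind g V E C > 0"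
proof -
  obtain es a where es: "C = set es" "proj.awalk a es a" "distinct es" "es \<noteq> []"
    using assms unfolding proj.cycle_sets_def proj.cycle_conv by blast
  then show ?thesis
    using closed_walk_shift_pos[OF es(2,4)] sum_list_distinct_conv_sum_set[OF es(3), of shift_of]
      cycle_wind_eq[OF assms] by simp
qed

lemma packing_sum_arc_series:
  "proj.packing_sum arc_series W =
    (\<Sum>Cs\<in>proj.packings W. fls_monom ((-1) ^ card Cs * multi_weight wt Cs) (multi_wind g V E Cs))"
  unfolding proj.packing_sum_def
proof (rule sum.cong[OF refl])
  fix Cs assume Cs: "Cs \<in> proj.packings W"
  then have sub: "C \<in> proj.cycle_sets" if "C \<in> Cs" for C
    using that by (auto simp: proj.packings_def)
  have "(\<Prod>C\<in>Cs. - (\<Prod>c\<in>C. arc_series c)) =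
      (\<Prod>C\<in>Cs. fls_monom (- cycle_weight wt C) (cycle_wind g V E C))"
  proof (rule prod.cong[OF refl])
    fix C assume "C \<in> Cs"
    then have C: "C \<in> proj.cycle_sets" by (rule sub)
    then have "finite C"
      using proj.cycle_sets_arcs finite_subset proj.finite_arcs by blast
    then show "- (\<Prod>c\<in>C. arc_series c) = fls_monom (- cycle_weight wt C) (cycle_wind g V E C)"
      by (simp add: arc_series_def fls_monom_prod fls_monom_uminus cycle_weight_def cycle_wind_eq[OF C])
  qed
  also have "\<dots> = fls_monom (\<Prod>C\<in>Cs. - cycle_weight wt C) (multi_wind g V E Cs)"
    unfolding multi_wind_def using proj.finite_packing[OF Cs] by (rule fls_monom_prod)
  also have "(\<Prod>C\<in>Cs. - cycle_weight wt C) = (-1) ^ card Cs * multi_weight wt Cs"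
    using prod.distrib[of "\<lambda>_. -1" "cycle_weight wt" Cs] by (simp add: multi_weight_def)
  finally show "(\<Prod>C\<in>Cs. - (\<Prod>c\<in>C. arc_series c)) =
      fls_monom ((-1) ^ card Cs * multi_weight wt Cs) (multi_wind g V E Cs)" .
qed

lemma empty_packing: "{} \<in> proj.packings W"
  by (simp add: proj.packings_def)

lemma max_wind_ge:
  assumes "Cs \<in> proj.packings (verts G)"
  shows "multi_wind g V E Cs \<le> max_wind g V E"
proof -
  have "(\<Union>r. r_cycles g V E r) = proj.packings (verts G)"
    by (auto simp: r_cycles_eq)
  then show ?thesis
    unfolding max_wind_def using assms proj.finite_packings by simp
qed

lemma max_wind_nonneg: "max_wind g V E \<ge> 0"
  using max_wind_ge[OF empty_packing] by (simp add: multi_wind_def)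

lemma multi_wind_pos:
  assumes "Cs \<in> proj.packings W" "Cs \<noteq> {}"
  shows "multi_wind g V E Cs > 0"
  unfolding multi_wind_def using assms proj.finite_packing[OF assms(1)] cycle_wind_pos
  by (intro sum_pos) (auto simp: proj.packings_def)

lemma multi_wind_nonneg: "Cs \<in> proj.packings W \<Longrightarrow> multi_wind g V E Cs \<ge> 0"
  using multi_wind_pos[of Cs W] by (cases "Cs = {}") (auto simp: multi_wind_def[of _ _ _ "{}"])

text \<open>The sign (-1)^(d-r) splits into a global (-1)^d and one sign per cycle, as in
  \<open>packing_sum_arc_series\<close>; the double sum just groups the packings by size.\<close>

lemma Q_poly_eq:
  "Q_poly g V E wt = (\<Sum>Cs\<in>proj.packings (verts G).
     monom ((-1) ^ nat (max_wind g V E) * ((-1) ^ card Cs * multi_weight wt Cs))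
       (nat (max_wind g V E - multi_wind g V E Cs)))"
proof -
  let ?d = "max_wind g V E" and ?P = "proj.packings (verts G)"
  let ?t = "\<lambda>Cs. monom (multi_weight wt Cs) (nat (?d - multi_wind g V E Cs))"
  have sign: "(-1) powi (?d - int r) = ((-1) ^ nat ?d * (-1) ^ r :: 'k)" for r
  proof -
    obtain D where "?d = int D"
      using max_wind_nonneg by (rule nonneg_int_cases)
    then show ?thesis
      by (cases "even r") (simp_all add: power_int_diff)
  qed
  have "{r. r_cycles g V E r \<noteq> {}} = card ` ?P"
    by (auto simp: r_cycles_eq)
  then have "Q_poly g V E wt = (\<Sum>r\<in>card ` ?P. \<Sum>Cs | Cs \<in> ?P \<and> card Cs = r.
      smult ((-1) ^ nat ?d * (-1) ^ card Cs) (?t Cs))"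
    unfolding Q_poly_def sign r_cycles_eq by (simp add: smult_sum_right)
  also have "\<dots> = (\<Sum>Cs\<in>?P. smult ((-1) ^ nat ?d * (-1) ^ card Cs) (?t Cs))"
    by (rule sum.image_gen[OF proj.finite_packings, symmetric])
  finally show ?thesis by (simp add: smult_monom mult.assoc)
qed

text \<open>Nonempty packings have positive winding number, so the empty one alone contributes to
  the exponent d and nothing can cancel there.\<close>

lemma
  shows degree_Q_poly: "degree (Q_poly g V E wt) = nat (max_wind g V E)"
    and lead_coeff_Q_poly: "lead_coeff (Q_poly g V E wt) = (-1) ^ nat (max_wind g V E)"
proof -
  let ?d = "max_wind g V E" and ?P = "proj.packings (verts G)"
  let ?c = "\<lambda>Cs. (-1) ^ nat ?d * ((-1) ^ card Cs * multi_weight wt Cs)"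
  let ?k = "\<lambda>Cs. nat (?d - multi_wind g V E Cs)"
  have "?k Cs = nat ?d \<longleftrightarrow> Cs = {}" if "Cs \<in> ?P" for Cs
    using multi_wind_pos[OF that] max_wind_ge[OF that]
    by (cases "Cs = {}") (simp_all add: multi_wind_def[of _ _ _ "{}"])
  then have "coeff (Q_poly g V E wt) (nat ?d) = (\<Sum>Cs\<in>?P. if Cs = {} then ?c Cs else 0)"
    unfolding Q_poly_eq coeff_sum coeff_monom by (intro sum.cong) auto
  then have coeff: "coeff (Q_poly g V E wt) (nat ?d) = (-1) ^ nat ?d"
    using proj.finite_packings empty_packing by (simp add: multi_weight_def)
  have "?k Cs \<le> nat ?d" if "Cs \<in> ?P" for Cs
    using multi_wind_nonneg[OF that] by simp
  then have "degree (Q_poly g V E wt) \<le> nat ?d"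
    unfolding Q_poly_eq
    by (intro degree_sum_le proj.finite_packings) (meson degree_monom_le order_trans)
  moreover have "degree (Q_poly g V E wt) \<ge> nat ?d"
    using coeff by (intro le_degree) simp
  ultimately show deg: "degree (Q_poly g V E wt) = nat ?d" by simp
  show "lead_coeff (Q_poly g V E wt) = (-1) ^ nat ?d"
    unfolding deg by (rule coeff)
qed

text \<open>Multiplying by X^wind lowers the index of the coefficient read by wind, so at
  \<open>pos v + n + d\<close> a packing picks out the path sum with index n + (d - wind), exactly
  where its monomial in Q_N puts it.\<close>

lemma recurrence_eq_series_coeff:
  assumes "u \<in> V" "v \<in> V"
  shows "(\<Sum>i\<le>degree (Q_poly g V E wt). coeff (Q_poly g V E wt) i *
      path_sum V E wt u (v + real (n + i) *\<^sub>R g)) =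
    (-1) ^ nat (max_wind g V E) * (proj.packing_sum arc_series (verts G) * path_series u (cls v)) $$
      (pos v + int n + max_wind g V E)"
proof -
  let ?d = "max_wind g V E" and ?P = "proj.packings (verts G)"
  let ?\<kappa> = "\<lambda>Cs. (-1) ^ card Cs * multi_weight wt Cs"
  have clsv: "cls v \<in> verts G" using assms by (simp add: verts_proj)
  have f: "path_sum V E wt u (v + real l *\<^sub>R g) = path_series u (cls v) $$ (pos v + int l)" for l
    using pt_shift[OF assms(2), of "int l"] by (simp add: path_series_nth[OF clsv])
  have "(\<Sum>i\<le>degree (Q_poly g V E wt). coeff (Q_poly g V E wt) i *
      path_sum V E wt u (v + real (n + i) *\<^sub>R g)) =
    (\<Sum>Cs\<in>?P. ((-1) ^ nat ?d * ?\<kappa> Cs) *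
      path_sum V E wt u (v + real (n + nat (?d - multi_wind g V E Cs)) *\<^sub>R g))"
  proof (rule sum_coeff_sum_monom[OF Q_poly_eq])
    fix Cs assume Cs: "Cs \<in> ?P"
    show "nat (?d - multi_wind g V E Cs) \<le> degree (Q_poly g V E wt)"
      using multi_wind_nonneg[OF Cs] by (simp add: degree_Q_poly)
  qed
  also have "\<dots> = (\<Sum>Cs\<in>?P. (-1) ^ nat ?d *
      (?\<kappa> Cs * path_series u (cls v) $$ (pos v + int n + ?d - multi_wind g V E Cs)))"
    by (rule sum.cong[OF refl]) (simp only: f, simp add: max_wind_ge algebra_simps)
  also have "\<dots> = (-1) ^ nat ?d *
      (proj.packing_sum arc_series (verts G) * path_series u (cls v)) $$ (pos v + int n + ?d)"
    unfolding packing_sum_arc_series sum_distrib_right fls_nth_sum fls_monom_times_nth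
      sum_distrib_left[symmetric] ..
  finally show ?thesis .
qed

end

theorem theorem2p1:
  fixes A B m :: real
    and V :: "point set" and E :: "(point \<times> point) set"
    and wt :: "point \<times> point \<Rightarrow> 'k::field_char_0"
    and u v :: point
  assumes "cylindrical_network A B m V E wt"
    and "u \<in> V" and "v \<in> V"
  shows "linear_recurrence (Q_poly (m, 0) V E wt)
           (\<lambda>l. path_sum V E wt u (v + real l *\<^sub>R (m, 0)))"
proof -
  interpret cylindrical_network A B m V E wt by fact
  have "cls v \<in> verts G" using assms(3) by (simp add: verts_proj)
  then obtain N where N: "\<And>k. k \<ge> N \<Longrightarrow>
      (proj.packing_sum arc_series (verts G) * path_series u (cls v)) $$ k = 0"
    using fls_bounded_packing_path_series[OF assms(2)]
    unfolding fls_bounded_def eventually_at_top_linorder by blast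
  \<comment> \<open>The bound on \<open>n\<close> places the coefficient index
    \<open>pos v + n + d\<close> at or beyond \<open>N\<close>.\<close>
  have "(\<Sum>i\<le>degree (Q_poly g V E wt). coeff (Q_poly g V E wt) i *
      path_sum V E wt u (v + real (n + i) *\<^sub>R g)) = 0"
    if "n \<ge> nat (N - pos v - max_wind g V E)" for n
    unfolding recurrence_eq_series_coeff[OF assms(2,3)] using that by (subst N) auto
  then have "\<forall>\<^sub>\<infinity>n. (\<Sum>i\<le>degree (Q_poly g V E wt). coeff (Q_poly g V E wt) i *
      path_sum V E wt u (v + real (n + i) *\<^sub>R g)) = 0"
    unfolding MOST_nat_le by blast
  moreover have "lead_coeff (Q_poly g V E wt) \<in> {1, -1}"
    unfolding lead_coeff_Q_poly by (cases "even (nat (max_wind g V E))") auto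
  ultimately show ?thesis
    unfolding linear_recurrence_def by blast
qed

end
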